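(* Let $n\ge2$ and $m\ge1$ be integers and set $\alpha=\left(\frac{\sqrt m}{\log n}\right)^{1/2}$. Let $G$ be an abelian group and $Y\subseteq G$ with $|Y|=n$. Let $\mathcal{F}_Y(m)$ be the family of all subsets $A\subseteq Y$ with $|A+A|\le m$. Then \[|\mathcal{F}_Y(m)|\le\begin{cases}2^{(2+3\alpha)\sqrt m\log n+m}&\text{if } m\le(\log n)^2,\\[2pt] 2^{\frac{m+\beta}{2}+2^{13}\alpha^{-2/3}m}&\text{if } m>(\log n)^2,\end{cases}\] where $\beta=\beta_G\big(m+\alpha^{-2/3}m\big)$. In particular, for a sequence of such $(G,Y)$ with $m=m(n)$: if $m=o((\log n)^2)$ then $|\mathcal{F}_Y(m)|\le n^{(2+o(1))\sqrt m}$, and if $(\log n)^2=o(m)$ then $|\mathcal{F}_Y(m)|\le 2^{\frac{m+\beta}{2}+o(m)}$.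
   Context: For an abelian group $G$ and real $x>0$, $\beta_G(x)$ denotes the largest size of a subgroup $H\le G$ with $|H|\le x$. For $A\subseteq G$, $A+A=\{a_1+a_2:a_1,a_2\in A\}$. Logarithms are base $2$. *)

theory Defs
  imports "HOL-Algebra.Algebra" "HOL-Library.Landau_Symbols" Complex_Main
begin

text \<open>
  Abelian groups are written multiplicatively, so the sumset $A + A$ is the library's set product
  \<open>A <#>\<^bsub>G\<^esub> A\<close>.  Since \<open>card\<close> is 0 on infinite sets, ``$|S| \le x$'' is
  spelled out with finiteness of \<open>S\<close>.
\<close>

text \<open>For \<open>x < 1\<close> no subgroup qualifies and the value is unspecified.\<close>

definition beta :: "('a, 'b) monoid_scheme \<Rightarrow> real \<Rightarrow> nat" where
  "beta G x = Max {card H | H. subgroup H G \<and> finite H \<and> real (card H) \<le> x}"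

definition alpha :: "nat \<Rightarrow> nat \<Rightarrow> real" where
  "alpha n m = (sqrt (real m) / log 2 (real n)) powr (1 / 2)"

definition small_sumset_family ::
    "('a, 'b) monoid_scheme \<Rightarrow> 'a set \<Rightarrow> nat \<Rightarrow> 'a set set" where
  "small_sumset_family G Y m =
     {A. A \<subseteq> Y \<and> finite (A <#>\<^bsub>G\<^esub> A) \<and> card (A <#>\<^bsub>G\<^esub> A) \<le> m}"

definition beta_at :: "('a, 'b) monoid_scheme \<Rightarrow> nat \<Rightarrow> nat \<Rightarrow> nat" where
  "beta_at G n m = beta G (real m + alpha n m powr (- 2 / 3) * real m)"

end

theory Submission
  imports Defs
begin

text \<open>
  Let $F \subseteq A$ and let $T \subseteq A$ be maximal such that adding its elements one by one
  enlarges $D = F + T$ by at least $d$ each time. Then $|T| \le m/d$, and $A$ lies in the set of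
  all $y$ with $|(y + F) \setminus D| < d$, which depends on $F$ and $T$ only and, by double
  counting, has at most $m|F|/(|F| - d)$ elements. With $d = \sqrt m$ and
  $|F| \approx (1 + \alpha)\sqrt m$ this is the sparse bound.

  In the dense case $|F| \approx 2\sqrt m$ gives containers $C$ of size at most $2m$, which are then
  shrunk. Put $\varepsilon = \alpha^{-2/3}$. A Pollard-type version of Kneser's theorem shows that
  if $|C|$ exceeds $(m+\beta)/2$ by $2\varepsilon m$, then for every $D$ with $|D| \le m$ at least
  $\varepsilon^2m^2$ pairs of $C \times C$ have their sum outside $D$. So there are many $x \in C$
  of high degree. If $A$ contains few of them, list these and discard the others. Otherwise
  choose $F$ among them and repeat the first step, so that $C$ shrinks or $D$ grows. In either case
  $|C| - |D|$ drops by a constant times $\varepsilon^2 m$ at the cost of $O(\sqrt m)$ elements of $A$, which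
  costs $O(\varepsilon^{-2}\sqrt m\log n) = O(\varepsilon m)$ bits altogether.
\<close>

section \<open>Pollard's inequality in abelian groups\<close>

context comm_group
begin

section \<open>Representation counts and Pollard's truncated sum\<close>

definition rep :: "'a set \<Rightarrow> 'a set \<Rightarrow> 'a \<Rightarrow> nat" where
  "rep A B x = card {p \<in> A \<times> B. fst p \<otimes> snd p = x}"

text \<open>Equivalently the sum over \<open>i\<close> from 1 to \<open>t\<close> of the number of
  elements with at least \<open>i\<close> representations, the quantity that Pollard's theorem
  bounds from below.\<close>

definition pollard_sum :: "nat \<Rightarrow> 'a set \<Rightarrow> 'a set \<Rightarrow> nat" where
  "pollard_sum t A B = (\<Sum>x\<in>A <#> B. min t (rep A B x))"

lemma set_mult_finite: "finite A \<Longrightarrow> finite B \<Longrightarrow> finite (A <#> B)"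
  by (auto simp: set_mult_def)

lemma set_multI: "a \<in> A \<Longrightarrow> b \<in> B \<Longrightarrow> a \<otimes> b \<in> A <#> B"
  unfolding set_mult_def by blast

lemma rep_eq_0: "x \<notin> A <#> B \<Longrightarrow> rep A B x = 0"
  unfolding rep_def set_mult_def by (auto simp: card_eq_0_iff)

text \<open>Elements outside \<open>A <#> B\<close> have no representations, so the index set may
  grow. This puts the truncated sums of several pairs over one common set.\<close>

lemma pollard_sum_superset:
  assumes "finite S" "A <#> B \<subseteq> S"
  shows "pollard_sum t A B = (\<Sum>x\<in>S. min t (rep A B x))"
  unfolding pollard_sum_def
  using assms by (intro sum.mono_neutral_left) (auto simp: rep_eq_0)

lemma rep_Un_left:
  assumes "finite A" "finite A'" "finite B" "A \<inter> A' = {}"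
  shows "rep (A \<union> A') B x = rep A B x + rep A' B x"
proof -
  have "{p \<in> (A \<union> A') \<times> B. fst p \<otimes> snd p = x} =
    {p \<in> A \<times> B. fst p \<otimes> snd p = x} \<union> {p \<in> A' \<times> B. fst p \<otimes> snd p = x}" by auto
  then show ?thesis
    unfolding rep_def using assms by (simp, subst card_Un_disjoint) auto
qed

lemma rep_commute:
  assumes "A \<subseteq> carrier G" "B \<subseteq> carrier G"
  shows "rep A B x = rep B A x"
  unfolding rep_def
  by (rule bij_betw_same_card[of prod.swap], rule bij_betw_byWitness[where f' = prod.swap])
     (use assms in \<open>auto simp: m_comm subset_iff\<close>)

lemma rep_Un_right:
  assumes "finite A" "finite B" "finite B'" "B \<inter> B' = {}"
    "A \<subseteq> carrier G" "B \<subseteq> carrier G" "B' \<subseteq> carrier G"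
  shows "rep A (B \<union> B') x = rep A B x + rep A B' x"
  using rep_Un_left[of B B' A x] assms rep_commute[of A "B \<union> B'" x] rep_commute[of A B x]
    rep_commute[of A B' x] by simp

lemma rep_le_card_right:
  assumes "finite B" "A \<subseteq> carrier G" "B \<subseteq> carrier G"
  shows "rep A B x \<le> card B"
  unfolding rep_def
  by (rule card_inj_on_le[of snd]) (use assms in \<open>auto simp: inj_on_def subset_iff\<close>)

lemma sum_rep:
  assumes "finite A" "finite B" "finite S"
  shows "(\<Sum>x\<in>S. rep A B x) = card {p \<in> A \<times> B. fst p \<otimes> snd p \<in> S}"
proof -
  have "card (\<Union>x\<in>S. {p \<in> A \<times> B. fst p \<otimes> snd p = x}) =
      (\<Sum>x\<in>S. card {p \<in> A \<times> B. fst p \<otimes> snd p = x})"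
    by (rule card_UN_disjoint) (use assms in auto)
  moreover have "(\<Union>x\<in>S. {p \<in> A \<times> B. fst p \<otimes> snd p = x}) = {p \<in> A \<times> B. fst p \<otimes> snd p \<in> S}"
    by auto
  ultimately show ?thesis by (simp add: rep_def)
qed

text \<open>Cut both sets along their intersection. By commutativity
  \<open>(A \<inter> B) \<times> (B - A)\<close> can be traded for
  \<open>(B - A) \<times> (A \<inter> B)\<close>, which together with
  \<open>A \<times> (A \<inter> B)\<close> makes up
  \<open>(A \<union> B) \<times> (A \<inter> B)\<close>; only
  \<open>(A - B) \<times> (B - A)\<close> remains.\<close>

lemma rep_union_inter:
  assumes "finite A" "finite B" "A \<subseteq> carrier G" "B \<subseteq> carrier G"
  shows "rep A B x = rep (A \<union> B) (A \<inter> B) x + rep (A - B) (B - A) x"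
proof -
  have "rep A ((A \<inter> B) \<union> (B - A)) x = rep A (A \<inter> B) x + rep A (B - A) x"
    by (rule rep_Un_right) (use assms in auto)
  moreover have "(A \<inter> B) \<union> (B - A) = B" by auto
  moreover have "rep ((A \<inter> B) \<union> (A - B)) (B - A) x = rep (A \<inter> B) (B - A) x + rep (A - B) (B - A) x"
    by (rule rep_Un_left) (use assms in auto)
  moreover have "(A \<inter> B) \<union> (A - B) = A" by auto
  moreover have "rep (A \<union> (B - A)) (A \<inter> B) x = rep A (A \<inter> B) x + rep (B - A) (A \<inter> B) x"
    by (rule rep_Un_left) (use assms in auto)
  moreover have "A \<union> (B - A) = A \<union> B" by auto
  moreover have "rep (B - A) (A \<inter> B) x = rep (A \<inter> B) (B - A) x"
    by (rule rep_commute) (use assms in auto)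
  ultimately show ?thesis by simp
qed

text \<open>Translation carries the representations of \<open>x\<close> bijectively to those of
  \<open>x \<otimes> e\<close>. Hence the induction may first move \<open>B\<close> to a convenient
  position relative to \<open>A\<close>.\<close>

lemma pollard_sum_translate:
  assumes "A \<subseteq> carrier G" "B \<subseteq> carrier G" "e \<in> carrier G"
  shows "pollard_sum t A ((\<lambda>b. b \<otimes> e) ` B) = pollard_sum t A B"
proof -
  have inj: "inj_on (\<lambda>b. b \<otimes> e) (A <#> B)"
    using assms by (auto simp: inj_on_def set_mult_def subset_iff)
  have im: "A <#> (\<lambda>b. b \<otimes> e) ` B = (\<lambda>b. b \<otimes> e) ` (A <#> B)"
  proof -
    have "a \<otimes> (b \<otimes> e) = a \<otimes> b \<otimes> e" if "a \<in> A" "b \<in> B" for a b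
      using assms that by (auto simp: m_assoc subset_iff)
    then show ?thesis unfolding set_mult_def by (simp add: image_UN)
  qed
  have rep: "rep A ((\<lambda>b. b \<otimes> e) ` B) (x \<otimes> e) = rep A B x" if "x \<in> A <#> B" for x
  proof -
    have x: "x \<in> carrier G" using that assms by (auto simp: set_mult_def subset_iff)
    have "bij_betw (\<lambda>p. (fst p, snd p \<otimes> e)) {p \<in> A \<times> B. fst p \<otimes> snd p = x}
       {p \<in> A \<times> (\<lambda>b. b \<otimes> e) ` B. fst p \<otimes> snd p = x \<otimes> e}"
      unfolding bij_betw_def
    proof
      show "inj_on (\<lambda>p. (fst p, snd p \<otimes> e)) {p \<in> A \<times> B. fst p \<otimes> snd p = x}"
        using assms by (auto simp: inj_on_def subset_iff)
      show "(\<lambda>p. (fst p, snd p \<otimes> e)) ` {p \<in> A \<times> B. fst p \<otimes> snd p = x} =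
         {p \<in> A \<times> (\<lambda>b. b \<otimes> e) ` B. fst p \<otimes> snd p = x \<otimes> e}" (is "?L = ?R")
      proof
        show "?L \<subseteq> ?R" using assms by (auto simp: m_assoc[symmetric] subset_iff)
        show "?R \<subseteq> ?L"
        proof
          fix p assume p: "p \<in> ?R"
          then obtain a b where ab: "p = (a, b \<otimes> e)" "a \<in> A" "b \<in> B" by auto
          have "a \<otimes> b \<otimes> e = x \<otimes> e" using p ab assms by (auto simp: m_assoc subset_iff)
          then have "a \<otimes> b = x" using x ab assms by (auto simp: subset_iff)
          with ab show "p \<in> ?L" by (auto intro!: image_eqI[of _ _ "(a,b)"])
        qed
      qed
    qed
    from bij_betw_same_card[OF this] show ?thesis by (simp add: rep_def)
  qed
  show ?thesis
    unfolding pollard_sum_def im by (subst sum.reindex[OF inj]) (simp add: rep)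
qed

text \<open>The obstruction to Pollard's induction. For \<open>b\<close>, \<open>c\<close> in
  \<open>B\<close> the translate of \<open>B\<close> by \<open>inv c \<otimes> a\<close> meets
  \<open>A\<close> in \<open>a\<close>, hence lies in \<open>A\<close>, so
  \<open>a \<otimes> (b \<otimes> inv c)\<close> is in \<open>A\<close>. Thus quotients of elements
  of \<open>B\<close> lie in the stabiliser \<open>H\<close> of \<open>A\<close>, and a coset of
  \<open>H\<close> lies in \<open>A\<close>.\<close>

lemma stabiliser_of_translate_dichotomy:
  assumes fin: "finite A" "finite B" and sub: "A \<subseteq> carrier G" "B \<subseteq> carrier G"
    and ne: "A \<noteq> {}" "B \<noteq> {}"
    and dich: "\<And>e. e \<in> carrier G \<Longrightarrow>
      A \<inter> (\<lambda>b. b \<otimes> e) ` B = {} \<or> (\<lambda>b. b \<otimes> e) ` B \<subseteq> A"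
  shows "\<exists>H. subgroup H G \<and> finite H \<and> card B \<le> card H \<and> card H \<le> card A \<and>
    (\<forall>a\<in>A. \<forall>b\<in>B. \<forall>c\<in>B. a \<otimes> (b \<otimes> inv c) \<in> A)"
proof -
  define H where "H = {h \<in> carrier G. \<forall>a\<in>A. a \<otimes> h \<in> A}"
  obtain a0 b0 where a0: "a0 \<in> A" and b0: "b0 \<in> B" using ne by auto
  have cA: "a \<in> carrier G" if "a \<in> A" for a using that sub by auto
  have cB: "b \<in> carrier G" if "b \<in> B" for b using that sub by auto
  have key: "a \<otimes> (b \<otimes> inv c) \<in> A" if "a \<in> A" "b \<in> B" "c \<in> B" for a b c
  proof -
    have e: "inv c \<otimes> a \<in> carrier G" using that cA cB by auto
    have "c \<otimes> (inv c \<otimes> a) = a" using that cA cB by (simp add: m_assoc[symmetric])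
    then have "a \<in> A \<inter> (\<lambda>b. b \<otimes> (inv c \<otimes> a)) ` B" using that
      by (intro IntI image_eqI[of _ _ c]) auto
    then have "b \<otimes> (inv c \<otimes> a) \<in> A" using dich[OF e] that by auto
    moreover have "b \<otimes> (inv c \<otimes> a) = a \<otimes> (b \<otimes> inv c)"
      using that cA cB by (metis inv_closed m_assoc m_closed m_comm)
    ultimately show ?thesis by simp
  qed
  have inA: "card H \<le> card A" and finH: "finite H"
  proof -
    have inj: "inj_on ((\<otimes>) a0) H" using a0 cA by (auto simp: inj_on_def H_def)
    have im: "(\<otimes>) a0 ` H \<subseteq> A" using a0 by (auto simp: H_def)
    show "card H \<le> card A" by (rule card_inj_on_le[OF inj im fin(1)])
    show "finite H" using inj im fin(1) by (meson finite_imageD finite_subset)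
  qed
  have sg: "subgroup H G"
  proof (rule subgroupI)
    show "H \<subseteq> carrier G" by (auto simp: H_def)
    have "\<one> \<in> H" using cA by (auto simp: H_def)
    then show "H \<noteq> {}" by auto
  next
    fix h assume h: "h \<in> H"
    then have hc: "h \<in> carrier G" by (auto simp: H_def)
    \<comment> \<open>Multiplication by \<open>h\<close> maps the finite set \<open>A\<close>
      injectively into itself, so it is onto; this yields closure under inverses.\<close>
    have onto: "(\<lambda>a. a \<otimes> h) ` A = A"
      by (rule endo_inj_surj) (use h hc cA fin in \<open>auto simp: H_def inj_on_def\<close>)
    have "a \<otimes> inv h \<in> A" if "a \<in> A" for a
    proof -
      have "a \<in> (\<lambda>a. a \<otimes> h) ` A" using that onto by simp
      then obtain a' where a': "a' \<in> A" "a = a' \<otimes> h" by blast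
      then show ?thesis using cA hc by (simp add: m_assoc)
    qed
    then show "inv h \<in> H" using hc by (auto simp: H_def)
  next
    fix g h assume "g \<in> H" "h \<in> H"
    then show "g \<otimes> h \<in> H" using cA by (auto simp: H_def m_assoc[symmetric])
  qed
  have "card B \<le> card H"
  proof (rule card_inj_on_le)
    show "inj_on (\<lambda>b. b \<otimes> inv b0) B" using b0 cB by (auto simp: inj_on_def)
    show "(\<lambda>b. b \<otimes> inv b0) ` B \<subseteq> H" using b0 cB key by (auto simp: H_def)
  qed (rule finH)
  with sg finH inA key show ?thesis by (intro exI[of _ H]) simp
qed

text \<open>Pollard's induction: after a translation, \<open>(A, B)\<close> is replaced by
  \<open>(A \<union> B, A \<inter> B)\<close> or by \<open>(A - B, B - A)\<close>.  Truncating at \<open>M\<close> is what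
  restricts the obstruction to subgroups of order at most \<open>M\<close> rather than \<open>|A| + |B| - t\<close>.\<close>

lemma pollard_kneser:
  fixes M \<beta> :: real
  assumes \<beta>: "\<And>H. subgroup H G \<Longrightarrow> finite H \<Longrightarrow> real (card H) \<le> M \<Longrightarrow> real (card H) \<le> \<beta>"
    and "0 \<le> \<beta>" "finite A" "finite B" "A \<subseteq> carrier G" "B \<subseteq> carrier G" "t \<le> card A" "t \<le> card B"
  shows "real t * min M (real (card A) + real (card B) - real t - \<beta>) \<le> real (pollard_sum t A B)"
  using assms(3-)
proof (induction "card B" arbitrary: A B t rule: less_induct)
  case less
  note fin = less.prems(1,2) and sub = less.prems(3,4)
  show ?case
  proof (cases "t = 0")
    case True then show ?thesis by simp
  next
    case False
    then have ne: "A \<noteq> {}" "B \<noteq> {}" using less.prems by auto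
    show ?thesis
    proof (cases "\<forall>e \<in> carrier G. A \<inter> (\<lambda>b. b \<otimes> e) ` B = {} \<or> (\<lambda>b. b \<otimes> e) ` B \<subseteq> A")
      case True
      then obtain H where H: "subgroup H G" "finite H" "card B \<le> card H" "card H \<le> card A"
        and st: "\<forall>a\<in>A. \<forall>b\<in>B. \<forall>c\<in>B. a \<otimes> (b \<otimes> inv c) \<in> A"
        using stabiliser_of_translate_dichotomy[OF fin sub ne] by auto
      obtain b0 where b0: "b0 \<in> B" using ne by auto
      let ?S = "(\<lambda>a. a \<otimes> b0) ` A"
      have inj: "inj_on (\<lambda>a. a \<otimes> b0) A" using b0 sub by (auto simp: inj_on_def subset_iff)
      \<comment> \<open>\<open>a \<otimes> b0\<close> equals
        \<open>(a \<otimes> (b0 \<otimes> inv b)) \<otimes> b\<close> for every \<open>b\<close> in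
        \<open>B\<close>, so each element of \<open>?S\<close> has at least
        \<open>card B \<ge> t\<close> representations.\<close>
      have full: "min t (rep A B x) = t" if x: "x \<in> ?S" for x
      proof -
        obtain a where a: "a \<in> A" "x = a \<otimes> b0" using x by auto
        have "(a \<otimes> (b0 \<otimes> inv b)) \<otimes> b = x" if "b \<in> B" for b
          using a b0 that sub by (auto simp: m_assoc subset_iff)
        then have "(\<lambda>b. (a \<otimes> (b0 \<otimes> inv b), b)) ` B \<subseteq> {p \<in> A \<times> B. fst p \<otimes> snd p = x}"
          using st a b0 by auto
        then have "card B \<le> rep A B x"
          unfolding rep_def by (intro card_inj_on_le) (auto simp: inj_on_def fin)
        then show ?thesis using less.prems by simp
      qed
      have "t * card A = (\<Sum>x\<in>?S. min t (rep A B x))"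
        using card_image[OF inj] by (simp add: full)
      also have "\<dots> \<le> pollard_sum t A B"
        unfolding pollard_sum_def using b0 fin
        by (intro sum_mono2) (auto simp: set_mult_def)
      finally have 1: "real t * real (card A) \<le> real (pollard_sum t A B)"
        by (metis of_nat_le_iff of_nat_mult)
      \<comment> \<open>If \<open>card H \<le> M\<close>, then
        \<open>card B \<le> card H \<le> \<beta>\<close> and the second term of the minimum is at
        most \<open>card A\<close>; otherwise \<open>M < card H \<le> card A\<close>.\<close>
      have "min M (real (card A) + real (card B) - real t - \<beta>) \<le> real (card A)"
      proof (cases "real (card H) \<le> M")
        case True
        then have "real (card H) \<le> \<beta>" using \<beta> H by blast
        then show ?thesis using H by linarith
      next
        case False then show ?thesis using H by linarith
      qed
      then show ?thesis
        by (rule order_trans[OF mult_left_mono 1]) simp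
    next
      case False
      then obtain e where e: "e \<in> carrier G" "A \<inter> (\<lambda>b. b \<otimes> e) ` B \<noteq> {}"
        "\<not> (\<lambda>b. b \<otimes> e) ` B \<subseteq> A" by blast
      define B' where "B' = (\<lambda>b. b \<otimes> e) ` B"
      have fB: "finite B'" and sB: "B' \<subseteq> carrier G" using fin sub e by (auto simp: B'_def)
      have cB: "card B' = card B"
        unfolding B'_def by (rule card_image) (use e sub in \<open>auto simp: inj_on_def subset_iff\<close>)
      define U I where "U = A \<union> B'" and "I = A \<inter> B'"
      define u i where "u = card U" and "i = card I"
      \<comment> \<open>The translate meets \<open>A\<close> without lying in it, so
        \<open>I\<close> and \<open>B' - A\<close> are both smaller than \<open>B\<close>, and the
        induction hypothesis applies with either as second set.\<close>
      have "I \<subset> B'" "I \<noteq> {}" using e by (auto simp: I_def B'_def)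
      then have i: "0 < i" "i < card B" "i \<le> card A"
        using fB fin psubset_card_mono[of B' I] cB
        by (auto simp: i_def I_def card_gt_0_iff intro!: card_mono)
      have ui: "u + i = card A + card B"
        using card_Un_Int[OF fin(1) fB] by (simp add: u_def i_def U_def I_def cB)
      have cD: "card (B' - A) = card B - i" "card (A - B') = card A - i"
        using card_Diff_subset_Int[of B' A] card_Diff_subset_Int[of A B'] fin fB
        by (auto simp: i_def I_def cB Int_commute)
      have fs: "finite U" "finite I" "U \<subseteq> carrier G" "I \<subseteq> carrier G"
        using fin fB sub sB by (auto simp: U_def I_def)
      let ?S = "(A <#> B') \<union> (U <#> I) \<union> ((A - B') <#> (B' - A))"
      have fS: "finite ?S" using fin fB fs by (auto intro!: set_mult_finite)
      have split: "rep A B' x = rep U I x + rep (A - B') (B' - A) x" for x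
        unfolding U_def I_def by (rule rep_union_inter[OF fin(1) fB sub(1) sB])
      have PB: "pollard_sum t A B = (\<Sum>x\<in>?S. min t (rep A B' x))"
        using pollard_sum_translate[OF sub e(1), of t] pollard_sum_superset[OF fS, of A B' t]
        by (auto simp: B'_def)
      define z where "z = real (card A) + real (card B) - real t - \<beta>"
      show ?thesis
      proof (cases "t \<le> i")
        case True
        have tu: "t \<le> card U" using True ui i u_def by linarith
        \<comment> \<open>Since \<open>u + i = card A + card B\<close>, the pair
          \<open>(U, I)\<close> yields the same bound, and its representation counts are no larger
          than those of \<open>(A, B')\<close>.\<close>
        have "real t * min M (real u + real i - real t - \<beta>) \<le> real (pollard_sum t U I)"
          using less.hyps[of I U t] i fs True tu by (simp add: u_def i_def)
        moreover have "pollard_sum t U I \<le> pollard_sum t A B"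
          unfolding PB by (subst pollard_sum_superset[OF fS]) (auto intro!: sum_mono simp: split)
        ultimately show ?thesis using ui by (simp flip: of_nat_add)
      next
        case False
        then have ti: "i < t" by simp
        \<comment> \<open>The bracket for the pair \<open>(A - B', B' - A)\<close> at level
          \<open>t - i\<close>: both sets and the level lose \<open>i\<close>, a net loss of
          \<open>i\<close>.\<close>
        define w where "w = real (card A) + real (card B) - real t - real i - \<beta>"
        have "real (t - i) * min M (real (card (A - B')) + real (card (B' - A)) - real (t - i) - \<beta>)
           \<le> real (pollard_sum (t - i) (A - B') (B' - A))"
          by (rule less.hyps) (use fin fB sub sB cD i ti less.prems in auto)
        then have IH: "(real t - real i) * min M w \<le> real (pollard_sum (t - i) (A - B') (B' - A))"
          using ti i by (simp add: cD w_def of_nat_diff algebra_simps)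
        \<comment> \<open>No element has more than \<open>i\<close> representations in
          \<open>U \<times> I\<close>, so all \<open>u * i\<close> of these pairs survive truncation
          and level \<open>t - i\<close> is left for the difference pair.\<close>
        have "pollard_sum (t - i) (A - B') (B' - A) + u * i =
           (\<Sum>x\<in>?S. min (t - i) (rep (A - B') (B' - A) x)) + (\<Sum>x\<in>?S. rep U I x)"
        proof -
          have "fst p \<otimes> snd p \<in> U <#> I" if "p \<in> U \<times> I" for p
            using that by (intro set_multI) auto
          then have "{p \<in> U \<times> I. fst p \<otimes> snd p \<in> ?S} = U \<times> I" by blast
          then have "(\<Sum>x\<in>?S. rep U I x) = card (U \<times> I)"
            unfolding sum_rep[OF fs(1,2) fS] by (rule arg_cong)
          then show ?thesis
            by (subst pollard_sum_superset[OF fS]) (auto simp: card_cartesian_product u_def i_def)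
        qed
        also have "\<dots> \<le> pollard_sum t A B"
          unfolding PB sum.distrib[symmetric]
        proof (rule sum_mono)
          fix x
          have "rep U I x \<le> i" unfolding i_def by (rule rep_le_card_right[OF fs(2-4)])
          then show "min (t - i) (rep (A - B') (B' - A) x) + rep U I x \<le> min t (rep A B' x)"
            using ti by (simp add: split)
        qed
        finally have low: "real (pollard_sum (t - i) (A - B') (B' - A)) + real u * real i \<le>
          real (pollard_sum t A B)" by (metis of_nat_add of_nat_le_iff of_nat_mult)
        have u: "real u = real (card A) + real (card B) - real i"
          using ui by linarith
        \<comment> \<open>Without truncation by \<open>M\<close> the right side exceeds the left by
          exactly \<open>i * \<beta>\<close>. If \<open>w > M\<close> then \<open>u \<ge> M\<close>,
          so each of the \<open>t\<close> levels contributes at least \<open>M\<close>.\<close>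
        have "real t * min M z \<le> (real t - real i) * min M w + real u * real i"
        proof (cases "w \<le> M")
          case True
          have "real t * z \<le> (real t - real i) * w + real u * real i"
          proof -
            have "(real t - real i) * w + real u * real i - real t * z = real i * \<beta>"
              by (simp add: u w_def z_def algebra_simps)
            then show ?thesis using \<open>0 \<le> \<beta>\<close> by (smt (verit) mult_nonneg_nonneg of_nat_0_le_iff)
          qed
          moreover have "real t * min M z \<le> real t * z" by (intro mult_left_mono) auto
          ultimately show ?thesis using True by (simp add: min_absorb2)
        next
          case False
          have "M \<le> real u" using False \<open>0 \<le> \<beta>\<close> ti u w_def by linarith
          then have "M * real i \<le> real u * real i" by (intro mult_right_mono) auto
          moreover have "real t * min M z \<le> real t * M" by (intro mult_left_mono) auto
          ultimately show ?thesis using False by (simp add: min_absorb1 algebra_simps)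
        qed
        then show ?thesis using IH low by (simp add: z_def)
      qed
    qed
  qed
qed

end


section \<open>Containers\<close>

lemma card_subsets_of_card_le:
  assumes "finite W" "card W \<le> n"
  shows "card {F. F \<subseteq> W \<and> card F = k} \<le> n ^ k"
proof (cases "k \<le> card W")
  case True
  have "card {F. F \<subseteq> W \<and> card F = k} \<le> card W ^ k"
    using n_subsets[OF assms(1)] binomial_le_pow[OF True] by simp
  also have "\<dots> \<le> n ^ k" by (rule power_mono) (use assms in auto)
  finally show ?thesis .
next
  case False
  then have "{F. F \<subseteq> W \<and> card F = k} = {}" using assms card_mono by fastforce
  then show ?thesis by (metis card.empty zero_le)
qed

text \<open>The hypothesis \<open>2 \<le> n\<close> absorbs the doubling that occurs each time the
  size bound is raised.\<close>

lemma card_subsets_of_card_less: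
  assumes "finite W" "card W \<le> n" "2 \<le> n"
  shows "card {S. S \<subseteq> W \<and> card S < k} \<le> n ^ k"
proof (induction k)
  case 0 then show ?case by simp
next
  case (Suc k)
  have eq: "{S. S \<subseteq> W \<and> card S < Suc k} = {S. S \<subseteq> W \<and> card S < k} \<union> {S. S \<subseteq> W \<and> card S = k}" by auto
  have "card {S. S \<subseteq> W \<and> card S < Suc k} \<le>
      card {S. S \<subseteq> W \<and> card S < k} + card {S. S \<subseteq> W \<and> card S = k}"
    unfolding eq by (rule card_Un_le)
  also have "\<dots> \<le> 2 * n ^ k" using Suc card_subsets_of_card_le[OF assms(1,2), of k] by simp
  also have "\<dots> \<le> n ^ Suc k" using assms by simp
  finally show ?case .
qed

text \<open>The binomial theorem on a power set; with \<open>x = 1 / n\<close> it sums the weights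
  of all candidate sets \<open>T\<close>.\<close>

lemma sum_Pow_power_card:
  fixes x :: "'b :: comm_semiring_1"
  assumes "finite C"
  shows "(\<Sum>T\<in>Pow C. x ^ card T) = (1 + x) ^ card C"
  using prod_add[OF assms, of "\<lambda>_. x" "\<lambda>_. 1"] by (simp add: add.commute)

section \<open>Families with a partly known sumset, and their containers\<close>

context comm_group
begin

text \<open>\<open>D\<close> is the part of the sumset already known; keeping it as a union (instead of demanding
  \<open>D \<subseteq> A <#> A\<close>) makes the family closed under subsets.\<close>

definition family :: "nat \<Rightarrow> 'a set \<Rightarrow> 'a set \<Rightarrow> 'a set set" where
  "family m C D = {A. A \<subseteq> C \<and> card ((A <#> A) \<union> D) \<le> m}"

text \<open>The degree of \<open>y\<close> into \<open>F\<close> in the graph joining two elements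
  when their product lies outside \<open>D\<close>.\<close>

definition codeg :: "'a set \<Rightarrow> 'a set \<Rightarrow> 'a \<Rightarrow> nat" where
  "codeg F D y = card {x \<in> F. y \<otimes> x \<notin> D}"

definition container :: "'a set \<Rightarrow> 'a set \<Rightarrow> 'a set \<Rightarrow> real \<Rightarrow> 'a set" where
  "container C F D d = {y \<in> C. real (codeg F D y) < d}"

lemma set_mult_subset_mono: "A \<subseteq> A' \<Longrightarrow> B \<subseteq> B' \<Longrightarrow> A <#> B \<subseteq> A' <#> B'"
  unfolding set_mult_def by blast

lemma finite_family: "finite C \<Longrightarrow> finite (family m C D)"
  unfolding family_def by (rule finite_subset[of _ "Pow C"]) auto

lemma family_empty_if_card_gt:
  assumes "finite C" "finite D" "m < card D"
  shows "family m C D = {}"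
proof -
  have le: "card D \<le> card ((A <#> A) \<union> D)" if "A \<subseteq> C" for A
    using that assms by (intro card_mono) (auto intro!: set_mult_finite dest: finite_subset)
  have "A \<notin> family m C D" for A
    using le[of A] assms(3) by (auto simp: family_def)
  then show ?thesis by blast
qed

lemma card_family_le_pow: "finite C \<Longrightarrow> card (family m C D) \<le> 2 ^ card C"
  using card_mono[of "Pow C" "family m C D"] by (auto simp: family_def card_Pow)

text \<open>Take \<open>T\<close> of largest size among the sets that enlarge \<open>D\<close> by
  \<open>d\<close> per element. An element of \<open>A\<close> with codegree at least
  \<open>d\<close> could be added to it.\<close>

lemma ex_maximal_extension:
  assumes "finite A" "finite F" "finite D" "A \<subseteq> carrier G" "F \<subseteq> carrier G" "0 < d"
  shows "\<exists>T\<subseteq>A. real (card D) + d * real (card T) \<le> real (card (D \<union> (T <#> F))) \<and>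
           (\<forall>y\<in>A. real (codeg F (D \<union> (T <#> F)) y) < d)"
proof -
  define P where "P T \<longleftrightarrow> T \<subseteq> A \<and> real (card D) + d * real (card T) \<le> real (card (D \<union> (T <#> F)))" for T
  have "P {}" by (simp add: P_def set_mult_def)
  moreover have "\<forall>T. P T \<longrightarrow> card T < Suc (card A)"
    using assms(1) by (auto simp: P_def less_Suc_eq_le card_mono)
  ultimately obtain T where T: "P T" and max: "\<And>T'. P T' \<Longrightarrow> card T' \<le> card T"
    using ex_has_greatest_nat[of P "{}" card "Suc (card A)"] by auto
  define D' where "D' = D \<union> (T <#> F)"
  have TA: "T \<subseteq> A" and fT: "finite T" using T assms(1) by (auto simp: P_def dest: finite_subset)
  have fD': "finite D'" using assms fT by (auto simp: D'_def intro!: set_mult_finite)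
  have "real (codeg F D' y) < d" if y: "y \<in> A" for y
  proof (rule ccontr)
    assume neg: "\<not> real (codeg F D' y) < d"
    \<comment> \<open>For \<open>y\<close> in \<open>T\<close> all products with \<open>F\<close>
      already lie in \<open>D'\<close>, so its codegree is 0, below \<open>d\<close>.\<close>
    have "y \<notin> T"
    proof
      assume "y \<in> T"
      then have "{x \<in> F. y \<otimes> x \<notin> D'} = {}" by (auto simp: D'_def intro: set_multI)
      then show False using neg \<open>0 < d\<close> by (simp only: codeg_def) simp
    qed
    let ?N = "(\<lambda>x. y \<otimes> x) ` {x \<in> F. y \<otimes> x \<notin> D'}"
    have cN: "card ?N = codeg F D' y"
      unfolding codeg_def by (rule card_image) (use assms y in \<open>auto simp: inj_on_def subset_iff\<close>)
    have "card D' + codeg F D' y = card (D' \<union> ?N)"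
      unfolding cN[symmetric] by (rule card_Un_disjoint[symmetric]) (use fD' assms in auto)
    also have "\<dots> \<le> card (D \<union> (insert y T <#> F))"
      using assms fT by (intro card_mono)
        (auto simp: D'_def set_mult_def intro!: set_mult_finite)
    finally have "real (card D) + d * real (card (insert y T)) \<le> real (card (D \<union> (insert y T <#> F)))"
      using T neg \<open>y \<notin> T\<close> fT by (simp add: P_def D'_def algebra_simps)
    then have "P (insert y T)" using TA y by (simp add: P_def)
    from max[OF this] show False using \<open>y \<notin> T\<close> fT by simp
  qed
  then show ?thesis using T by (auto simp: P_def D'_def)
qed

text \<open>\<open>F\<close> and \<open>T\<close> together are a fingerprint of \<open>A\<close>. As
  both lie in \<open>A\<close>, the set \<open>T <#> F\<close> is part of \<open>A <#> A\<close>, so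
  it joins the known part without changing the union.\<close>

lemma family_superset_decomposition:
  assumes "finite C" "finite D" "finite F" "C \<subseteq> carrier G" "F \<subseteq> carrier G" "0 < d"
  shows "{A \<in> family m C D. F \<subseteq> A} \<subseteq>
    (\<Union>T\<in>{T \<in> Pow C. real (card D) + d * real (card T) \<le> real (card (D \<union> (T <#> F)))}.
       family m (container C F (D \<union> (T <#> F)) d) (D \<union> (T <#> F)))"
proof
  fix A assume A: "A \<in> {A \<in> family m C D. F \<subseteq> A}"
  then have AC: "A \<subseteq> C" and FA: "F \<subseteq> A" and m: "card ((A <#> A) \<union> D) \<le> m" by (auto simp: family_def)
  have fA: "finite A" using AC assms finite_subset by blast
  obtain T where T: "T \<subseteq> A" "real (card D) + d * real (card T) \<le> real (card (D \<union> (T <#> F)))"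
    "\<forall>y\<in>A. real (codeg F (D \<union> (T <#> F)) y) < d"
    using ex_maximal_extension[of A F D d] assms AC fA by auto
  have "T <#> F \<subseteq> A <#> A" using T FA by (intro set_mult_subset_mono)
  then have "(A <#> A) \<union> (D \<union> (T <#> F)) = (A <#> A) \<union> D" by blast
  then have "A \<in> family m (container C F (D \<union> (T <#> F)) d) (D \<union> (T <#> F))"
    using T AC m by (auto simp: family_def container_def)
  with T AC show "A \<in> (\<Union>T\<in>{T \<in> Pow C. real (card D) + d * real (card T) \<le> real (card (D \<union> (T <#> F)))}.
       family m (container C F (D \<union> (T <#> F)) d) (D \<union> (T <#> F)))" by blast
qed

text \<open>The sets \<open>T\<close> are weighted rather than counted: each element of
  \<open>T\<close> enlarges \<open>D\<close> by \<open>d\<close> and so costs the exponent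
  \<open>(m - card D) / d\<close> one unit. Thus \<open>T\<close> has weight
  \<open>(1 / n) ^ card T\<close>, and these weights sum to at most
  \<open>(1 + 1 / n) ^ n \<le> 3\<close>.\<close>

lemma card_family_superset_le:
  fixes K :: real
  assumes "finite C" "finite D" "finite F" "C \<subseteq> carrier G" "F \<subseteq> carrier G" "0 < d"
    and n: "0 < n" "card C \<le> n" and "0 \<le> K"
    and step: "\<And>D'. finite D' \<Longrightarrow> D \<subseteq> D' \<Longrightarrow> card D' \<le> m \<Longrightarrow>
      real (card (family m (container C F D' d) D')) \<le> K * real n powr ((real m - real (card D')) / d)"
  shows "real (card {A \<in> family m C D. F \<subseteq> A}) \<le> 3 * K * real n powr ((real m - real (card D)) / d)"
proof -
  let ?D' = "\<lambda>T. D \<union> (T <#> F)"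
  let ?I = "{T \<in> Pow C. real (card D) + d * real (card T) \<le> real (card (?D' T))}"
  let ?V = "real n powr ((real m - real (card D)) / d)"
  have fI: "finite ?I" using assms by auto
  have bound: "real (card (family m (container C F (?D' T) d) (?D' T))) \<le> K * ?V * (1 / real n) ^ card T"
    if T: "T \<in> ?I" for T
  proof (cases "card (?D' T) \<le> m")
    case True
    have fD: "finite (?D' T)" using T assms by (auto intro!: set_mult_finite dest: finite_subset)
    have "real (card (family m (container C F (?D' T) d) (?D' T))) \<le>
        K * real n powr ((real m - real (card (?D' T))) / d)"
      by (rule step) (use fD True in auto)
    also have "\<dots> \<le> K * real n powr ((real m - real (card D)) / d - real (card T))"
    proof (intro mult_left_mono powr_mono)
      have "real (card T) \<le> (real (card (?D' T)) - real (card D)) / d"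
        using T \<open>0 < d\<close> by (simp add: pos_le_divide_eq algebra_simps)
      then show "(real m - real (card (?D' T))) / d \<le> (real m - real (card D)) / d - real (card T)"
        by (simp add: diff_divide_distrib)
    qed (use n \<open>0 \<le> K\<close> in auto)
    also have "\<dots> = K * ?V * (1 / real n) ^ card T"
      using n by (simp add: powr_diff powr_realpow power_one_over field_simps)
    finally show ?thesis .
  next
    case False
    \<comment> \<open>Once the known part has more than \<open>m\<close> elements no set
      qualifies.\<close>
    have "family m (container C F (?D' T) d) (?D' T) = {}"
      by (rule family_empty_if_card_gt)
         (use False T assms in \<open>auto simp: container_def intro!: set_mult_finite dest: finite_subset\<close>)
    then show ?thesis using \<open>0 \<le> K\<close> by simp
  qed
  have "real (card {A \<in> family m C D. F \<subseteq> A}) \<le>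
      real (card (\<Union>T\<in>?I. family m (container C F (?D' T) d) (?D' T)))"
    using family_superset_decomposition[OF assms(1-6), of m] fI assms(1)
    by (intro of_nat_mono card_mono) (auto intro!: finite_family simp: container_def)
  also have "\<dots> \<le> (\<Sum>T\<in>?I. real (card (family m (container C F (?D' T) d) (?D' T))))"
    unfolding of_nat_sum[symmetric] by (intro of_nat_mono card_UN_le fI)
  also have "\<dots> \<le> (\<Sum>T\<in>?I. K * ?V * (1 / real n) ^ card T)"
    by (rule sum_mono) (rule bound)
  also have "\<dots> \<le> (\<Sum>T\<in>Pow C. K * ?V * (1 / real n) ^ card T)"
    by (rule sum_mono2) (use assms in auto)
  also have "\<dots> = K * ?V * (1 + 1 / real n) ^ card C"
    using sum_Pow_power_card[OF assms(1), of "1 / real n"] by (simp add: sum_distrib_left[symmetric])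
  also have "\<dots> \<le> K * ?V * 3"
  proof (rule mult_left_mono)
    have "(1 + 1 / real n) ^ card C \<le> (1 + 1 / real n) ^ n"
      by (rule power_increasing) (use n in auto)
    also have "\<dots> \<le> exp 1" using exp_ge_one_plus_x_over_n_power_n[of n 1] n by simp
    also have "\<dots> \<le> 3" by (rule exp_le)
    finally show "(1 + 1 / real n) ^ card C \<le> 3" .
  qed (use \<open>0 \<le> K\<close> in auto)
  finally show ?thesis by (simp add: algebra_simps)
qed

section \<open>Sizes of containers, and splitting a family along a subset\<close>

lemma card_filter_mult_right_le:
  assumes "finite E" "x \<in> carrier G" "C \<subseteq> carrier G"
  shows "card {y \<in> C. y \<otimes> x \<in> E} \<le> card E"
  by (rule card_inj_on_le[of "\<lambda>y. y \<otimes> x"]) (use assms in \<open>auto simp: inj_on_def subset_iff\<close>)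

text \<open>Double count the pairs \<open>(y, x)\<close> with \<open>y \<otimes> x\<close> in
  \<open>D\<close>: each \<open>y\<close> in the container has more than \<open>card F - d\<close>
  partners in \<open>F\<close>, and each \<open>x\<close> in \<open>F\<close> has at most
  \<open>card D\<close> partners.\<close>

lemma card_container_le:
  assumes "finite C" "finite D" "finite F" "C \<subseteq> carrier G" "F \<subseteq> carrier G"
  shows "real (card (container C F D d)) * (real (card F) - d) \<le> real (card F) * real (card D)"
proof -
  let ?C = "container C F D d"
  have sub: "?C \<subseteq> C" "finite ?C" using assms by (auto simp: container_def)
  have "real (card ?C) * (real (card F) - d) = (\<Sum>y\<in>?C. real (card F) - d)" by simp
  also have "\<dots> \<le> (\<Sum>y\<in>?C. real (card {x \<in> F. y \<otimes> x \<in> D}))"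
  proof (rule sum_mono)
    fix y assume "y \<in> ?C"
    moreover have "card F = card {x \<in> F. y \<otimes> x \<in> D} + codeg F D y"
      unfolding codeg_def using assms
      by (subst card_Un_disjoint[symmetric]) (auto intro!: arg_cong[of _ _ card])
    ultimately show "real (card F) - d \<le> real (card {x \<in> F. y \<otimes> x \<in> D})"
      by (simp add: container_def)
  qed
  also have "\<dots> = real (\<Sum>x\<in>F. card {y \<in> ?C. y \<otimes> x \<in> D})"
    unfolding of_nat_sum[symmetric]
    by (rule arg_cong[of _ _ real], rule sum_multicount_gen) (use sub assms in auto)
  also have "\<dots> \<le> real (\<Sum>x\<in>F. card D)"
    using sub assms by (intro of_nat_mono sum_mono card_filter_mult_right_le) auto
  finally show ?thesis by simp
qed

text \<open>\<open>A\<close> is recovered from \<open>A \<inter> W\<close> and \<open>A - W\<close>,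
  and the latter stays in the family because the family is closed under subsets.\<close>

lemma card_family_few_le:
  assumes "finite C" "finite D" "W \<subseteq> C" "card W \<le> n" "2 \<le> n"
  shows "card {A \<in> family m C D. card (A \<inter> W) < k} \<le> n ^ k * card (family m (C - W) D)"
proof -
  let ?S = "{S. S \<subseteq> W \<and> card S < k}"
  have fW: "finite W" using assms finite_subset by blast
  have "card {A \<in> family m C D. card (A \<inter> W) < k} \<le> card (?S \<times> family m (C - W) D)"
  proof (rule card_inj_on_le)
    show "inj_on (\<lambda>A. (A \<inter> W, A - W)) {A \<in> family m C D. card (A \<inter> W) < k}"
      by (auto simp: inj_on_def)
    have "A - W \<in> family m (C - W) D" if A: "A \<in> family m C D" for A
    proof -
      have "(A - W <#> A - W) \<union> D \<subseteq> (A <#> A) \<union> D" using set_mult_subset_mono[of "A - W" A "A - W" A] by blast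
      moreover have "finite ((A <#> A) \<union> D)"
        using A assms by (auto simp: family_def intro!: set_mult_finite dest: finite_subset)
      ultimately have "card ((A - W <#> A - W) \<union> D) \<le> card ((A <#> A) \<union> D)" by (intro card_mono)
      then show ?thesis using A by (auto simp: family_def)
    qed
    then show "(\<lambda>A. (A \<inter> W, A - W)) ` {A \<in> family m C D. card (A \<inter> W) < k} \<subseteq> ?S \<times> family m (C - W) D"
      by auto
    show "finite (?S \<times> family m (C - W) D)"
      using fW assms by (auto intro!: finite_family finite_subset[of ?S "Pow W"])
  qed
  also have "\<dots> \<le> n ^ k * card (family m (C - W) D)"
    using card_subsets_of_card_less[OF fW assms(4,5)] by (simp add: card_cartesian_product)
  finally show ?thesis .
qed

text \<open>Union bound over the at most \<open>n ^ k\<close> subsets \<open>F\<close> of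
  \<open>W\<close> of size \<open>k\<close>, one of which lies in \<open>A\<close>.\<close>

lemma card_family_many_le:
  fixes b :: real
  assumes "finite C" "W \<subseteq> C" "card W \<le> n"
    and b: "\<And>F. F \<subseteq> W \<Longrightarrow> card F = k \<Longrightarrow> real (card {A \<in> family m C D. F \<subseteq> A}) \<le> b" and "0 \<le> b"
  shows "real (card {A \<in> family m C D. k \<le> card (A \<inter> W)}) \<le> real n ^ k * b"
proof -
  let ?S = "{F. F \<subseteq> W \<and> card F = k}"
  have fW: "finite W" using assms finite_subset by blast
  then have fS: "finite ?S" by (auto intro: finite_subset[of _ "Pow W"])
  have "{A \<in> family m C D. k \<le> card (A \<inter> W)} \<subseteq> (\<Union>F\<in>?S. {A \<in> family m C D. F \<subseteq> A})"
  proof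
    fix A assume A: "A \<in> {A \<in> family m C D. k \<le> card (A \<inter> W)}"
    then obtain F where "F \<subseteq> A \<inter> W" "card F = k"
      using obtain_subset_with_card_n[of k "A \<inter> W"] by blast
    then show "A \<in> (\<Union>F\<in>?S. {A \<in> family m C D. F \<subseteq> A})" using A by blast
  qed
  then have "card {A \<in> family m C D. k \<le> card (A \<inter> W)} \<le> card (\<Union>F\<in>?S. {A \<in> family m C D. F \<subseteq> A})"
    using fS finite_family[OF assms(1)] by (intro card_mono) auto
  also have "\<dots> \<le> (\<Sum>F\<in>?S. card {A \<in> family m C D. F \<subseteq> A})" by (rule card_UN_le[OF fS])
  finally have "real (card {A \<in> family m C D. k \<le> card (A \<inter> W)}) \<le>
      (\<Sum>F\<in>?S. real (card {A \<in> family m C D. F \<subseteq> A}))"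
    unfolding of_nat_sum[symmetric] by (rule of_nat_mono)
  also have "\<dots> \<le> real (card ?S) * b" by (rule sum_bounded_above) (use b in auto)
  also have "\<dots> \<le> real (n ^ k) * b"
    using card_subsets_of_card_le[OF fW assms(3), of k] assms by (intro mult_right_mono of_nat_mono) auto
  finally show ?thesis by simp
qed

text \<open>Apply the Pollard bound to \<open>C\<close> with itself. Elements of \<open>D\<close>
  contribute at most \<open>t\<close> each to the truncated sum; the remainder is at most the number
  of ordered pairs with product outside \<open>D\<close>, which is the sum of codegrees.\<close>

lemma supersaturation:
  fixes M \<beta> :: real
  assumes \<beta>: "\<And>H. subgroup H G \<Longrightarrow> finite H \<Longrightarrow> real (card H) \<le> M \<Longrightarrow> real (card H) \<le> \<beta>"
    and "0 \<le> \<beta>" "finite C" "finite D" "C \<subseteq> carrier G" "t \<le> card C"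
  shows "real t * (min M (2 * real (card C) - real t - \<beta>) - real (card D)) \<le> (\<Sum>x\<in>C. real (codeg C D x))"
proof -
  let ?S = "C <#> C"
  have fS: "finite ?S" using assms by (intro set_mult_finite)
  have 1: "real t * min M (2 * real (card C) - real t - \<beta>) \<le> real (pollard_sum t C C)"
    using pollard_kneser[of M \<beta> C C t] assms by simp
  have "pollard_sum t C C = (\<Sum>z\<in>?S \<inter> D. min t (rep C C z)) + (\<Sum>z\<in>?S - D. min t (rep C C z))"
    unfolding pollard_sum_def using sum.Int_Diff[OF fS] by blast
  also have "\<dots> \<le> (\<Sum>z\<in>?S \<inter> D. t) + (\<Sum>z\<in>?S - D. rep C C z)"
    by (intro add_mono sum_mono) auto
  also have "(\<Sum>z\<in>?S - D. rep C C z) = card {p \<in> C \<times> C. fst p \<otimes> snd p \<in> ?S - D}"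
    by (rule sum_rep) (use assms fS in auto)
  also have "{p \<in> C \<times> C. fst p \<otimes> snd p \<in> ?S - D} = (SIGMA x:C. {y \<in> C. x \<otimes> y \<notin> D})"
    using set_multI by fastforce
  also have "card \<dots> = (\<Sum>x\<in>C. codeg C D x)" using assms by (simp add: codeg_def)
  also have "(\<Sum>z\<in>?S \<inter> D. t) \<le> t * card D"
    using card_mono[of D "?S \<inter> D"] assms by simp
  finally have "pollard_sum t C C \<le> t * card D + (\<Sum>x\<in>C. codeg C D x)" by simp
  then have "real (pollard_sum t C C) \<le> real (t * card D + (\<Sum>x\<in>C. codeg C D x))"
    by (rule of_nat_mono)
  with 1 show ?thesis by (simp add: algebra_simps)
qed

text \<open>Count the pairs in \<open>F \<times> C\<close> with product outside \<open>D\<close>, at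
  least \<open>card F * h\<close> in number. An element outside the new container accounts for at
  most \<open>card F\<close> of them; one inside has fewer than \<open>d\<close> products outside
  \<open>D'\<close>; and each \<open>x\<close> in \<open>F\<close> has at most
  \<open>card (D' - D)\<close> products in \<open>D' - D\<close>. So \<open>C\<close> shrinks or
  \<open>D\<close> grows.\<close>

lemma potential_drop:
  fixes h d :: real
  assumes fin: "finite C" "finite D'" and sub: "C \<subseteq> carrier G" "F \<subseteq> C" "D \<subseteq> D'"
    and h: "\<And>x. x \<in> F \<Longrightarrow> h \<le> real (codeg C D x)" and "0 \<le> d"
  shows "real (card F) * h \<le> real (card F) * (real (card C) - real (card (container C F D' d)))
     + real (card C) * d + real (card F) * (real (card D') - real (card D))"
proof -
  let ?C = "container C F D' d" and ?k = "real (card F)"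
  have fF: "finite F" and cF: "F \<subseteq> carrier G" using fin sub by (auto dest: finite_subset)
  have CC: "?C \<subseteq> C" by (auto simp: container_def)
  have "?k * h \<le> (\<Sum>x\<in>F. real (codeg C D x))" using sum_mono[of F "\<lambda>_. h", OF h] by simp
  also have "\<dots> = real (\<Sum>x\<in>F. card {y \<in> C. y \<otimes> x \<notin> D})"
    unfolding of_nat_sum codeg_def
  proof (intro sum.cong refl)
    fix x assume "x \<in> F"
    then have "{y \<in> C. x \<otimes> y \<notin> D} = {y \<in> C. y \<otimes> x \<notin> D}" using sub by (auto simp: m_comm subset_iff)
    then show "real (card {y \<in> C. x \<otimes> y \<notin> D}) = real (card {y \<in> C. y \<otimes> x \<notin> D})" by simp
  qed
  also have "(\<Sum>x\<in>F. card {y \<in> C. y \<otimes> x \<notin> D}) = (\<Sum>y\<in>C. codeg F D y)"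
    unfolding codeg_def by (rule sum_multicount_gen[symmetric]) (use fF fin in auto)
  also have "real \<dots> \<le> real (\<Sum>y\<in>C. codeg F D' y + card {x \<in> F. y \<otimes> x \<in> D' - D})"
  proof (intro of_nat_mono sum_mono)
    fix y
    have "codeg F D y \<le> card ({x \<in> F. y \<otimes> x \<notin> D'} \<union> {x \<in> F. y \<otimes> x \<in> D' - D})"
      unfolding codeg_def by (rule card_mono) (use fF in auto)
    also have "\<dots> \<le> codeg F D' y + card {x \<in> F. y \<otimes> x \<in> D' - D}"
      unfolding codeg_def by (rule card_Un_le)
    finally show "codeg F D y \<le> codeg F D' y + card {x \<in> F. y \<otimes> x \<in> D' - D}" .
  qed
  also have "\<dots> = (\<Sum>y\<in>C. real (codeg F D' y)) + real (\<Sum>y\<in>C. card {x \<in> F. y \<otimes> x \<in> D' - D})"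
    by (simp add: sum.distrib)
  also have "(\<Sum>y\<in>C. card {x \<in> F. y \<otimes> x \<in> D' - D}) = (\<Sum>x\<in>F. card {y \<in> C. y \<otimes> x \<in> D' - D})"
    by (rule sum_multicount_gen) (use fF fin in auto)
  also have "real \<dots> \<le> real (\<Sum>x\<in>F. card (D' - D))"
    using fin sub cF by (intro of_nat_mono sum_mono card_filter_mult_right_le) auto
  also have "(\<Sum>x\<in>F. card (D' - D)) = card F * (card D' - card D)"
    using card_Diff_subset[OF finite_subset[OF sub(3) fin(2)] sub(3)] by simp
  also have "real \<dots> = ?k * (real (card D') - real (card D))"
    using card_mono[of D' D] fin sub by (simp add: of_nat_diff)
  also have "(\<Sum>y\<in>C. real (codeg F D' y)) \<le> real (card C) * d + ?k * (real (card C) - real (card ?C))"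
  proof -
    have "(\<Sum>y\<in>C. real (codeg F D' y)) = (\<Sum>y\<in>C - ?C. real (codeg F D' y)) + (\<Sum>y\<in>?C. real (codeg F D' y))"
      by (rule sum.subset_diff[OF CC fin(1)])
    also have "\<dots> \<le> (\<Sum>y\<in>C - ?C. ?k) + (\<Sum>y\<in>?C. d)"
      by (intro add_mono sum_mono) (auto simp: container_def codeg_def intro!: card_mono fF)
    also have "\<dots> = (real (card C) - real (card ?C)) * ?k + real (card ?C) * d"
      using card_Diff_subset[of ?C C] CC fin finite_subset[OF CC] card_mono[OF fin(1) CC] by (simp add: of_nat_diff)
    also have "real (card ?C) * d \<le> real (card C) * d"
      using card_mono[OF fin(1) CC] \<open>0 \<le> d\<close> by (intro mult_right_mono) auto
    finally show ?thesis by (simp add: algebra_simps)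
  qed
  finally show ?thesis by simp
qed

text \<open>Iterated shrinking. Up to \<open>thr\<close> the trivial bound \<open>2 ^ card C\<close>
  suffices. Above it, both alternatives lower the potential \<open>card C + m - card D\<close> by at
  least \<open>h / 2\<close>, and \<open>q\<close> is chosen so that this saves
  \<open>n ^ (k + 2)\<close>: \<open>n ^ k\<close> pays for listing elements of \<open>A\<close>,
  and \<open>n ^ 2\<close> for constants. The term with \<open>d\<close> pays for the sets
  \<open>T\<close>; the value of \<open>d\<close> makes \<open>2 * m * d\<close> half of
  \<open>k * h\<close>.\<close>

lemma card_family_le_of_supersaturation:
  fixes h d q thr :: real
  assumes n: "2 \<le> n" and m: "1 \<le> m" and k: "1 \<le> k" and h: "0 < h"
    and d: "d = real k * h / (4 * real m)" and q: "q = 2 * (real k + 2) / h"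
    and sat: "\<And>C D. finite C \<Longrightarrow> C \<subseteq> carrier G \<Longrightarrow> finite D \<Longrightarrow> card D \<le> m \<Longrightarrow> card C \<le> 2 * m \<Longrightarrow>
      thr < real (card C) \<Longrightarrow> 4 * real m * h \<le> (\<Sum>x\<in>C. real (codeg C D x))"
    and "finite C" "C \<subseteq> carrier G" "finite D" "card D \<le> m" "card C \<le> 2 * m" "card C \<le> n"
  shows "real (card (family m C D)) \<le>
    2 powr thr * real n powr (q * (real (card C) + real m - real (card D)) + (real m - real (card D)) / d)"
  using assms(8-)
proof (induction "card C + (m - card D)" arbitrary: C D rule: less_induct)
  case less
  note C = \<open>finite C\<close> \<open>C \<subseteq> carrier G\<close> and D = \<open>finite D\<close> \<open>card D \<le> m\<close>
    and cC = \<open>card C \<le> 2 * m\<close> \<open>card C \<le> n\<close>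
  define \<psi> where "\<psi> = real (card C) + real m - real (card D)"
  define \<phi> where "\<phi> = (real m - real (card D)) / d"
  have d0: "0 < d" and q0: "0 < q" using assms(1-4) by (auto simp: d q)
  have \<psi>0: "0 \<le> \<psi>" and \<phi>0: "0 \<le> \<phi>" using D d0 by (auto simp: \<psi>_def \<phi>_def)
  have n1: "1 \<le> real n" "0 < real n" using n by auto
  have pw: "real n ^ k * real n powr (x - (real k + 2)) = real n powr x / (real n)\<^sup>2" for x
  proof -
    have "real n powr (x - (real k + 2)) = real n powr x / (real n ^ k * (real n)\<^sup>2)"
      using n1 powr_realpow[of "real n" k] by (simp add: powr_diff powr_add)
    then show ?thesis using n1 by simp
  qed
  let ?B = "2 powr thr * real n powr (q * \<psi> + \<phi>)"
  have "real (card (family m C D)) \<le> ?B"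
  proof (cases "real (card C) \<le> thr")
    case True
    have "real (card (family m C D)) \<le> real (2 ^ card C)"
      by (intro of_nat_mono card_family_le_pow C)
    also have "\<dots> = 2 powr real (card C)" by (simp add: powr_realpow)
    also have "\<dots> \<le> 2 powr thr * 1" using True by simp
    also have "\<dots> \<le> ?B"
      using n1 q0 \<psi>0 \<phi>0 by (intro mult_left_mono ge_one_powr_ge_zero) auto
    finally show ?thesis .
  next
    case False
    define W where "W = {x \<in> C. h \<le> real (codeg C D x)}"
    have W: "W \<subseteq> C" "finite W" using C by (auto simp: W_def)
    have cW: "card W \<le> n" using card_mono[OF C(1) W(1)] cC by simp
    \<comment> \<open>Elements outside \<open>W\<close> contribute at most \<open>2 * m * h\<close>
      of the total \<open>4 * m * h\<close>, and those in \<open>W\<close> have degree at most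
      \<open>2 * m\<close>.\<close>
    have hW: "h \<le> real (card W)"
    proof -
      have "4 * real m * h \<le> (\<Sum>x\<in>C. real (codeg C D x))" by (rule sat) (use C D cC False in auto)
      also have "\<dots> = (\<Sum>x\<in>C - W. real (codeg C D x)) + (\<Sum>x\<in>W. real (codeg C D x))"
        by (rule sum.subset_diff[OF W(1) C(1)])
      also have "\<dots> \<le> (\<Sum>x\<in>C - W. h) + (\<Sum>x\<in>W. real (card C))"
        by (intro add_mono sum_mono) (auto simp: W_def codeg_def intro!: card_mono C)
      also have "\<dots> = real (card (C - W)) * h + real (card W) * real (card C)" by simp
      also have "\<dots> \<le> real (2 * m) * h + real (card W) * real (2 * m)"
      proof (intro add_mono mult_right_mono mult_left_mono)
        show "real (card (C - W)) \<le> real (2 * m)"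
          using card_mono[of C "C - W"] C cC by simp
        show "real (card C) \<le> real (2 * m)" using cC by (simp only: of_nat_le_iff)
      qed (use h in auto)
      finally have "2 * real m * h \<le> 2 * real m * real (card W)" by (simp add: algebra_simps)
      then show ?thesis using m by simp
    qed
    \<comment> \<open>List the few elements of \<open>A \<inter> W\<close> and delete
      \<open>W\<close> from \<open>C\<close>. The potential falls by at least \<open>h\<close>, and
      \<open>n ^ 2 \<ge> 4\<close> leaves a quarter of the bound.\<close>
    have few: "real (card {A \<in> family m C D. card (A \<inter> W) < k}) \<le> ?B / 4"
    proof -
      have cd: "card (C - W) = card C - card W" "card W \<le> card C" "0 < card W"
        using card_Diff_subset[OF W(2,1)] card_mono[OF C(1) W(1)] hW h by auto
      have "real (card (family m (C - W) D)) \<le> 2 powr thr * real n powr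
          (q * (real (card (C - W)) + real m - real (card D)) + (real m - real (card D)) / d)"
        by (rule less.hyps) (use C D cC cd in auto)
      also have "\<dots> \<le> 2 powr thr * real n powr (q * \<psi> + \<phi> - (real k + 2))"
      proof (intro mult_left_mono powr_mono)
        have "q * (real (card (C - W)) + real m - real (card D)) \<le> q * (\<psi> - h)"
          using hW cd q0 by (intro mult_left_mono) (auto simp: \<psi>_def of_nat_diff)
        also have "\<dots> = q * \<psi> - 2 * (real k + 2)" using h by (simp add: q field_simps)
        finally show "q * (real (card (C - W)) + real m - real (card D)) + (real m - real (card D)) / d
           \<le> q * \<psi> + \<phi> - (real k + 2)" by (simp add: \<phi>_def)
      qed (use n1 in auto)
      finally have "real n ^ k * real (card (family m (C - W) D)) \<le>
         real n ^ k * (2 powr thr * real n powr (q * \<psi> + \<phi> - (real k + 2)))"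
        by (intro mult_left_mono) auto
      also have "\<dots> = 2 powr thr * (real n ^ k * real n powr (q * \<psi> + \<phi> - (real k + 2)))" by simp
      also have "\<dots> = ?B / (real n)\<^sup>2" unfolding pw by simp
      also have "\<dots> \<le> ?B / 4"
        using power_mono[of 2 "real n" 2] n by (intro divide_left_mono) auto
      finally show ?thesis
        using of_nat_mono[OF card_family_few_le[OF C(1) D(1) W(1) cW n, of m k], where 'a = real]
        by simp
    qed
    \<comment> \<open>Fix \<open>k\<close> elements of \<open>A \<inter> W\<close> as
      \<open>F\<close> and pass to its containers. The factor 3 from summing over \<open>T\<close>,
      with \<open>n ^ 2 \<ge> 4\<close>, gives the other three quarters.\<close>
    have many: "real (card {A \<in> family m C D. k \<le> card (A \<inter> W)}) \<le> 3 * ?B / 4"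
    proof -
      define K where "K = 2 powr thr * real n powr (q * \<psi> - (real k + 2))"
      have K0: "0 \<le> K" by (simp add: K_def)
      have "real (card {A \<in> family m C D. F \<subseteq> A}) \<le> 3 * K * real n powr \<phi>"
        if F: "F \<subseteq> W" "card F = k" for F
        unfolding \<phi>_def
      proof (rule card_family_superset_le)
        fix D' assume D': "finite D'" "D \<subseteq> D'" "card D' \<le> m"
        let ?C = "container C F D' d"
        have CC: "?C \<subseteq> C" by (auto simp: container_def)
        have "real (card F) * h \<le> real (card F) * (real (card C) - real (card ?C))
          + real (card C) * d + real (card F) * (real (card D') - real (card D))"
          by (rule potential_drop) (use C D' F W d0 in \<open>auto simp: W_def\<close>)
        also have "real (card C) * d \<le> real (2 * m) * d"
          using cC d0 by (intro mult_right_mono of_nat_mono) auto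
        also have "\<dots> = real k * (h / 2)" using m by (simp add: d)
        finally have "real k * h \<le> real k * (real (card C) - real (card ?C) + h / 2 + (real (card D') - real (card D)))"
          by (simp add: F algebra_simps)
        then have drop: "real (card ?C) + real m - real (card D') \<le> \<psi> - h / 2"
          using k by (simp add: \<psi>_def)
        have "card ?C + (m - card D') < card C + (m - card D)"
          using drop h D D' by (simp add: \<psi>_def)
        then have "real (card (family m ?C D')) \<le> 2 powr thr * real n powr
            (q * (real (card ?C) + real m - real (card D')) + (real m - real (card D')) / d)"
          by (rule less.hyps) (use C D' cC CC card_mono[OF C(1) CC] in \<open>auto dest: finite_subset\<close>)
        also have "\<dots> \<le> 2 powr thr * real n powr (q * \<psi> - (real k + 2) + (real m - real (card D')) / d)"
        proof (intro mult_left_mono powr_mono add_right_mono)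
          have "q * (real (card ?C) + real m - real (card D')) \<le> q * (\<psi> - h / 2)"
            using drop q0 by (intro mult_left_mono) auto
          also have "\<dots> = q * \<psi> - (real k + 2)" using h by (simp add: q field_simps)
          finally show "q * (real (card ?C) + real m - real (card D')) \<le> q * \<psi> - (real k + 2)" .
        qed (use n1 in auto)
        finally show "real (card (family m ?C D')) \<le> K * real n powr ((real m - real (card D')) / d)"
          by (simp only: K_def powr_add mult.assoc)
      qed (use C D F W cC n d0 K0 in \<open>auto dest: finite_subset\<close>)
      then have "real (card {A \<in> family m C D. k \<le> card (A \<inter> W)}) \<le> real n ^ k * (3 * K * real n powr \<phi>)"
        by (intro card_family_many_le C W cW) (use K0 in auto)
      also have "\<dots> = 3 * 2 powr thr * (real n ^ k * real n powr (q * \<psi> - (real k + 2))) * real n powr \<phi>"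
        by (simp add: K_def)
      also have "\<dots> = 3 * (?B / (real n)\<^sup>2)" unfolding pw by (simp add: powr_add)
      also have "\<dots> \<le> 3 * (?B / 4)"
        using power_mono[of 2 "real n" 2] n by (intro mult_left_mono divide_left_mono) auto
      finally show ?thesis by simp
    qed
    have split: "family m C D = {A \<in> family m C D. card (A \<inter> W) < k} \<union> {A \<in> family m C D. k \<le> card (A \<inter> W)}"
      by auto
    have "card (family m C D) \<le>
        card {A \<in> family m C D. card (A \<inter> W) < k} + card {A \<in> family m C D. k \<le> card (A \<inter> W)}"
      by (subst split) (rule card_Un_le)
    then show ?thesis using few many by linarith
  qed
  then show ?case by (simp add: \<psi>_def \<phi>_def)
qed

end


section \<open>The two bounds\<close>

lemma nat_ceiling_bounds:
  fixes x :: real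
  assumes "0 \<le> x"
  shows "x \<le> real (nat \<lceil>x\<rceil>)" "real (nat \<lceil>x\<rceil>) \<le> x + 1"
  using assms by (auto simp: of_nat_nat)

lemma alpha_pos:
  assumes "2 \<le> n" "1 \<le> m"
  shows "0 < alpha n m" "(alpha n m)\<^sup>2 * log 2 (real n) = sqrt (real m)" "1 \<le> log 2 (real n)"
proof -
  show L: "1 \<le> log 2 (real n)" using assms by simp
  have pos: "0 < sqrt (real m) / log 2 (real n)" using assms L by (intro divide_pos_pos) auto
  then show "0 < alpha n m" by (simp only: alpha_def powr_gt_zero)
  have "(alpha n m)\<^sup>2 = sqrt (real m) / log 2 (real n)"
    using pos unfolding alpha_def by (simp add: powr_half_sqrt)
  then show "(alpha n m)\<^sup>2 * log 2 (real n) = sqrt (real m)" using L by simp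
qed

text \<open>The balance behind the exponent -2/3: with \<epsilon> = \<alpha>^(-2/3), the iteration
  cost \<epsilon>^(-2) sqrt(m) log n equals \<epsilon> m, the order of the slack in the container
  size.\<close>

lemma alpha_powr_cube:
  assumes "2 \<le> n" "1 \<le> m"
  shows "(alpha n m powr (- 2 / 3)) ^ 3 * sqrt (real m) = log 2 (real n)"
proof -
  note a = alpha_pos[OF assms]
  have "(alpha n m powr (- 2 / 3)) ^ 3 = alpha n m powr (- 2)"
    using a(1) by (simp add: powr_power)
  also have "\<dots> = 1 / (alpha n m)\<^sup>2" using a by (simp add: powr_minus_divide powr_numeral)
  finally show ?thesis using a(1) by (simp add: a(2)[symmetric])
qed

text \<open>The orders concerned are integers at most \<open>M\<close>, so \<open>Max\<close> is
  taken over a finite set.\<close>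

lemma beta_ge_card:
  assumes "subgroup H G" "finite H" "real (card H) \<le> M"
  shows "card H \<le> beta G M"
proof -
  have "{card H | H. subgroup H G \<and> finite H \<and> real (card H) \<le> M} \<subseteq> {..nat \<lfloor>M\<rfloor>}"
    by (auto simp: le_nat_floor)
  then have "finite {card H | H. subgroup H G \<and> finite H \<and> real (card H) \<le> M}"
    by (rule finite_subset) simp
  then show ?thesis unfolding beta_def using assms by (intro Max_ge) auto
qed

section \<open>The first round of containers; the sparse and the dense bound\<close>

context comm_group
begin

lemma card_le_card_set_mult:
  assumes "finite A" "finite B" "A \<subseteq> carrier G" "B \<subseteq> carrier G" "A \<noteq> {}"
  shows "card B \<le> card (A <#> B)"
proof -
  obtain a where a: "a \<in> A" using assms by auto
  show ?thesis
    by (rule card_inj_on_le[of "\<lambda>b. a \<otimes> b"])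
       (use assms a in \<open>auto simp: inj_on_def subset_iff intro: set_multI set_mult_finite\<close>)
qed

text \<open>Either \<open>A\<close> has fewer than \<open>f\<close> elements or it contains an
  \<open>F\<close> of size \<open>f\<close>. In the latter case the known part starts as
  \<open>F <#> F\<close>, which has at least \<open>f\<close> elements; this lowers the exponent for
  \<open>T\<close> from \<open>m / d\<close> to \<open>(m - f) / d\<close>.\<close>

lemma card_family_first_round:
  fixes d K :: real
  assumes Y: "finite Y" "Y \<subseteq> carrier G" "card Y = n" and n: "2 \<le> n" and f: "1 \<le> f" and d: "0 < d"
    and K: "0 \<le> K"
    and step: "\<And>C D. C \<subseteq> Y \<Longrightarrow> finite D \<Longrightarrow> card D \<le> m \<Longrightarrow>
      real (card C) * (real f - d) \<le> real f * real m \<Longrightarrow> real (card (family m C D)) \<le> K"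
  shows "real (card (family m Y {})) \<le> real n ^ f * (1 + 3 * K * real n powr ((real m - real f) / d))"
proof -
  let ?V = "real n powr ((real m - real f) / d)"
  have n1: "1 \<le> real n" using n by simp
  have few: "real (card {A \<in> family m Y {}. card (A \<inter> Y) < f}) \<le> real n ^ f"
  proof -
    have "card {A \<in> family m Y {}. card (A \<inter> Y) < f} \<le> n ^ f * card (family m (Y - Y) {})"
      by (rule card_family_few_le) (use Y n in auto)
    also have "\<dots> \<le> n ^ f * 1" using card_family_le_pow[of "{}" m "{}"] by (intro mult_left_mono) auto
    finally have "real (card {A \<in> family m Y {}. card (A \<inter> Y) < f}) \<le> real (n ^ f)"
      by (intro of_nat_mono) simp
    then show ?thesis by simp
  qed
  have many: "real (card {A \<in> family m Y {}. f \<le> card (A \<inter> Y)}) \<le> real n ^ f * (3 * K * ?V)"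
  proof (rule card_family_many_le)
    fix F assume F: "F \<subseteq> Y" "card F = f"
    have fF: "finite F" "F \<subseteq> carrier G" "F \<noteq> {}" using F Y f by (auto dest: finite_subset)
    have fFF: "finite (F <#> F)" using fF by (intro set_mult_finite)
    have cFF: "f \<le> card (F <#> F)" using card_le_card_set_mult[of F F] fF F by simp
    have "{A \<in> family m Y {}. F \<subseteq> A} = {A \<in> family m Y (F <#> F). F \<subseteq> A}"
    proof -
      have "(A <#> A) \<union> (F <#> F) = A <#> A" if "F \<subseteq> A" for A using set_mult_subset_mono[OF that that] by blast
      then show ?thesis by (auto simp: family_def)
    qed
    then have "real (card {A \<in> family m Y {}. F \<subseteq> A}) = real (card {A \<in> family m Y (F <#> F). F \<subseteq> A})" by simp
    also have "\<dots> \<le> 3 * K * real n powr ((real m - real (card (F <#> F))) / d)"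
    proof (rule card_family_superset_le)
      fix D' assume D': "finite D'" "F <#> F \<subseteq> D'" "card D' \<le> m"
      let ?C = "container Y F D' d"
      have "real (card ?C) * (real (card F) - d) \<le> real (card F) * real (card D')"
        by (rule card_container_le) (use Y fF D' in auto)
      also have "\<dots> \<le> real f * real m" using D' F by (auto intro!: mult_left_mono)
      finally have "real (card (family m ?C D')) \<le> K * 1"
        using step[of ?C D'] D' F by (auto simp: container_def)
      also have "\<dots> \<le> K * real n powr ((real m - real (card D')) / d)"
        using n1 d D' K by (intro mult_left_mono ge_one_powr_ge_zero) auto
      finally show "real (card (family m ?C D')) \<le> K * real n powr ((real m - real (card D')) / d)" .
    qed (use Y n d K fF fFF in auto)
    also have "\<dots> \<le> 3 * K * ?V"
      using cFF d n1 K by (intro mult_left_mono powr_mono divide_right_mono) auto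
    finally show "real (card {A \<in> family m Y {}. F \<subseteq> A}) \<le> 3 * K * ?V" .
  qed (use Y K in auto)
  have split: "family m Y {} = {A \<in> family m Y {}. card (A \<inter> Y) < f} \<union> {A \<in> family m Y {}. f \<le> card (A \<inter> Y)}"
    by auto
  have "card (family m Y {}) \<le>
      card {A \<in> family m Y {}. card (A \<inter> Y) < f} + card {A \<in> family m Y {}. f \<le> card (A \<inter> Y)}"
    by (subst split) (rule card_Un_le)
  then have "real (card (family m Y {})) \<le> real n ^ f + real n ^ f * (3 * K * ?V)"
    using few many by linarith
  then show ?thesis by (simp add: algebra_simps)
qed

lemma small_sumset_family_eq_family:
  assumes "finite Y"
  shows "small_sumset_family G Y m = family m Y {}"
  using assms unfolding small_sumset_family_def family_def
  by (auto intro!: set_mult_finite dest: finite_subset)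

lemma card_family_sparse:
  assumes Y: "finite Y" "Y \<subseteq> carrier G" "card Y = n" and n: "2 \<le> n" and m: "1 \<le> m"
    and sparse: "real m \<le> (log 2 (real n))\<^sup>2"
  shows "real (card (family m Y {})) \<le>
    2 powr ((2 + 3 * alpha n m) * sqrt (real m) * log 2 (real n) + real m)"
proof -
  define L where "L = log 2 (real n)"
  define \<alpha> where "\<alpha> = alpha n m"
  define r where "r = sqrt (real m)"
  have \<alpha>0: "0 < \<alpha>" and \<alpha>L: "\<alpha>\<^sup>2 * L = r" and L1: "1 \<le> L"
    using alpha_pos[OF n m] by (auto simp: \<alpha>_def L_def r_def)
  have r1: "1 \<le> r" and rr: "r * r = real m" using m by (auto simp: r_def)
  have n2: "real n = 2 powr L" using n by (simp add: L_def)
  have npow: "real n powr x = 2 powr (x * L)" for x by (simp add: n2 powr_powr mult.commute)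
  have n1: "1 \<le> real n" using n by simp
  show ?thesis
  proof (cases "m = 1")
    case True
    \<comment> \<open>Here \<open>A\<close> has at most one element. This case is separate because
      absorbing the constant 4 below needs \<open>m \<ge> 2\<close>.\<close>
    have "A \<in> {S. S \<subseteq> Y \<and> card S < 2}" if A: "A \<in> family m Y {}" for A
    proof (cases "A = {}")
      case False
      then have "card A \<le> card (A <#> A)"
        using A Y by (intro card_le_card_set_mult) (auto simp: family_def dest: finite_subset)
      then show ?thesis using A True by (auto simp: family_def)
    qed simp
    then have "card (family m Y {}) \<le> card {S. S \<subseteq> Y \<and> card S < 2}"
      using Y by (intro card_mono) (auto intro: finite_subset[of _ "Pow Y"])
    also have "\<dots> \<le> n ^ 2" by (rule card_subsets_of_card_less) (use Y n in auto)
    finally have "real (card (family m Y {})) \<le> real (n ^ 2)" by (rule of_nat_mono)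
    also have "\<dots> = real n powr 2" using n by (simp add: powr_numeral)
    also have "\<dots> = 2 powr (2 * L)" by (rule npow)
    also have "\<dots> \<le> 2 powr ((2 + 3 * \<alpha>) * r * L + real m)"
      using True \<alpha>0 L1 by (intro powr_mono) (auto simp: r_def algebra_simps)
    finally show ?thesis by (simp add: \<alpha>_def r_def L_def)
  next
    case False
    then have m2: "2 \<le> real m" using m by linarith
    have rL: "r \<le> L"
      unfolding r_def by (rule real_le_lsqrt) (use sparse L1 in \<open>auto simp: L_def\<close>)
    have \<alpha>1: "\<alpha> \<le> 1"
    proof (rule ccontr)
      assume "\<not> \<alpha> \<le> 1"
      then have "1 < \<alpha>\<^sup>2" by simp
      then have "1 * L < \<alpha>\<^sup>2 * L" using L1 by (intro mult_strict_right_mono) auto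
      then show False using \<alpha>L rL by simp
    qed
    \<comment> \<open>As \<open>f \<ge> (1 + \<alpha>) * r\<close>, containers have at most
      \<open>m * f / (f - r) \<le> m + m / \<alpha>\<close> elements, and
      \<open>m / \<alpha> = \<alpha> * r * L\<close>; this gives the exponent of
      \<open>K\<close>.\<close>
    define f where "f = nat \<lceil>r + \<alpha> * r\<rceil>"
    have f: "r + \<alpha> * r \<le> real f" "real f \<le> r + \<alpha> * r + 1"
      using nat_ceiling_bounds[of "r + \<alpha> * r"] r1 \<alpha>0 by (simp_all add: f_def)
    have ar: "0 < \<alpha> * r" using \<alpha>0 r1 by simp
    have f1: "1 \<le> f" using f ar r1 by linarith
    define K where "K = 2 powr (real m + \<alpha> * r * L)"
    have "(\<alpha> * r * L) * \<alpha> = (\<alpha>\<^sup>2 * L) * r" by (simp add: power2_eq_square)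
    then have mK: "real m = (\<alpha> * r * L) * \<alpha>" using rr by (simp only: \<alpha>L)
    have "real (card (family m Y {})) \<le> real n ^ f * (1 + 3 * K * real n powr ((real m - real f) / r))"
    proof (rule card_family_first_round[OF Y n f1])
      fix C D assume C: "C \<subseteq> Y" and h: "real (card C) * (real f - r) \<le> real f * real m"
      have fC: "finite C" using C Y by (auto dest: finite_subset)
      have "(real m + \<alpha> * r * L) * (real f - r) - real f * real m = \<alpha> * r * L * (real f - r - \<alpha> * r)"
        using mK rr by (simp add: algebra_simps)
      also have "\<dots> \<ge> 0" using f \<alpha>0 r1 L1 by (intro mult_nonneg_nonneg) auto
      finally have "real (card C) * (real f - r) \<le> (real m + \<alpha> * r * L) * (real f - r)" using h by linarith
      then have cC: "real (card C) \<le> real m + \<alpha> * r * L" using f ar by simp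
      have "real (card (family m C D)) \<le> real (2 ^ card C)"
        by (intro of_nat_mono card_family_le_pow fC)
      also have "\<dots> = 2 powr real (card C)" by (simp add: powr_realpow)
      also have "\<dots> \<le> K" unfolding K_def using cC by simp
      finally show "real (card (family m C D)) \<le> K" .
    qed (use r1 in \<open>auto simp: K_def\<close>)
    also have "\<dots> = real n powr real f + 3 * K * real n powr (real f + (real m - real f) / r)"
      using n by (simp add: powr_realpow powr_add algebra_simps)
    also have "\<dots> \<le> K * real n powr (2 * r + \<alpha> * r) + 3 * K * real n powr (2 * r + \<alpha> * r)"
    proof (intro add_mono mult_left_mono)
      have "1 * real n powr real f \<le> K * real n powr (2 * r + \<alpha> * r)"
        using f r1 n1 ar L1 by (intro mult_mono powr_mono) (auto simp: K_def intro!: ge_one_powr_ge_zero)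
      then show "real n powr real f \<le> K * real n powr (2 * r + \<alpha> * r)" by simp
      \<comment> \<open>Since \<open>f \<ge> r\<close>, starting from \<open>F <#> F\<close> saves
        one power of \<open>n\<close>, which cancels the rounding of \<open>f\<close>.\<close>
      have "real m - real f \<le> (r - 1) * r" using f ar by (simp add: algebra_simps rr)
      then have "(real m - real f) / r \<le> r - 1" using r1 by (simp add: pos_divide_le_eq)
      then have "real f + (real m - real f) / r \<le> 2 * r + \<alpha> * r" using f by linarith
      then show "real n powr (real f + (real m - real f) / r) \<le> real n powr (2 * r + \<alpha> * r)"
        using n1 by (intro powr_mono) auto
    qed (auto simp: K_def)
    also have "\<dots> = 2 powr (2 + (real m + \<alpha> * r * L) + (2 * r + \<alpha> * r) * L)"
      unfolding K_def npow by (simp add: powr_add)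
    also have "\<dots> \<le> 2 powr ((2 + 3 * \<alpha>) * r * L + real m)"
    proof (rule powr_mono)
      \<comment> \<open>The constant 4 is absorbed through
        \<open>2 \<le> m \<le> \<alpha> * r * L\<close>. The three terms
        \<open>\<alpha> * r * L\<close> come from this constant, the container size and the choice
        of \<open>f\<close>.\<close>
      have "\<alpha> * r * L * \<alpha> \<le> \<alpha> * r * L * 1" using \<alpha>1 ar L1 by (intro mult_left_mono) auto
      then have "2 \<le> \<alpha> * r * L" using mK m2 by linarith
      then show "2 + (real m + \<alpha> * r * L) + (2 * r + \<alpha> * r) * L \<le> (2 + 3 * \<alpha>) * r * L + real m"
        by (simp add: algebra_simps)
    qed simp
    finally show ?thesis by (simp add: \<alpha>_def r_def L_def)
  qed
qed

lemma card_family_dense: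
  assumes Y: "finite Y" "Y \<subseteq> carrier G" "card Y = n" and n: "2 \<le> n" and m: "1 \<le> m"
    and dense: "(log 2 (real n))\<^sup>2 < real m"
  shows "real (card (family m Y {})) \<le>
    2 powr ((real m + real (beta_at G n m)) / 2 + 2 ^ 13 * alpha n m powr (- 2 / 3) * real m)"
proof -
  define L where "L = log 2 (real n)"
  define \<epsilon> where "\<epsilon> = alpha n m powr (- 2 / 3)"
  define r where "r = sqrt (real m)"
  define M where "M = real m + \<epsilon> * real m"
  define \<beta> where "\<beta> = real (beta_at G n m)"
  have \<alpha>0: "0 < alpha n m" and L1: "1 \<le> L" using alpha_pos[OF n m] by (auto simp: L_def)
  have r1: "1 \<le> r" and rr: "r * r = real m" using m by (auto simp: r_def)
  have n1: "1 \<le> real n" using n by simp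
  have n2: "real n = 2 powr L" using n by (simp add: L_def)
  have npow: "real n powr x = 2 powr (x * L)" for x by (simp add: n2 powr_powr mult.commute)
  have \<epsilon>0: "0 < \<epsilon>" using \<alpha>0 by (simp add: \<epsilon>_def)
  have \<epsilon>L: "\<epsilon> ^ 3 * r = L" unfolding \<epsilon>_def r_def L_def by (rule alpha_powr_cube[OF n m])
  have "\<epsilon> ^ 3 * (r * r) = r * (\<epsilon> ^ 3 * r)" by simp
  then have \<epsilon>3: "\<epsilon> ^ 3 * real m = r * L" by (simp only: rr \<epsilon>L)
  have Lr: "L < r" unfolding r_def by (rule real_less_rsqrt) (use dense in \<open>simp add: L_def\<close>)
  have \<epsilon>1: "\<epsilon> < 1"
  proof (rule ccontr)
    assume "\<not> \<epsilon> < 1"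
    then have "1 \<le> \<epsilon> ^ 3" by (simp add: one_le_power)
    then have "1 * r \<le> \<epsilon> ^ 3 * r" using r1 by (intro mult_right_mono) auto
    then show False using \<epsilon>L Lr by simp
  qed
  \<comment> \<open>Hence a factor \<open>n powr (c * r)\<close> with \<open>c \<ge> 0\<close> costs
    at most \<open>c * \<epsilon> * m\<close> bits.\<close>
  have rLm: "r * L \<le> \<epsilon> * real m"
  proof -
    have "\<epsilon> ^ 3 * real m \<le> \<epsilon> ^ 1 * real m"
      using \<epsilon>0 \<epsilon>1 by (intro mult_right_mono power_decreasing) auto
    then show ?thesis using \<epsilon>3 by simp
  qed
  have em: "1 \<le> \<epsilon> * real m"
    using rLm mult_mono[of 1 r 1 L] r1 L1 by linarith
  \<comment> \<open>The slack \<open>2 * \<epsilon> * m\<close> is doubled in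
    \<open>2 * card C\<close>; after subtracting \<open>t \<le> 2 * \<epsilon> * m\<close> the
    bracket still exceeds \<open>M\<close>. The value of \<open>h\<close> makes
    \<open>4 * m * h\<close> the pair count
    \<open>(\<epsilon> * m) * (\<epsilon> * m)\<close>.\<close>
  define thr where "thr = (real m + \<beta>) / 2 + 2 * (\<epsilon> * real m)"
  define h where "h = \<epsilon>\<^sup>2 * real m / 4"
  \<comment> \<open>Order sqrt(m) balances \<open>q\<close>, which grows with \<open>k\<close>,
    against \<open>1 / d\<close>, which is inverse to \<open>k\<close>.\<close>
  define k where "k = nat \<lceil>r\<rceil>"
  have k: "r \<le> real k" "real k \<le> 2 * r" using nat_ceiling_bounds[of r] r1
    unfolding k_def by linarith+
  then have k1: "1 \<le> k" using r1 by linarith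
  define d where "d = real k * h / (4 * real m)"
  define q where "q = 2 * (real k + 2) / h"
  have h0: "0 < h" using \<epsilon>0 m by (simp add: h_def)
  have q0: "0 < q" and d0: "0 < d" using h0 k1 m by (auto simp: q_def d_def)
  have \<beta>0: "0 \<le> \<beta>" by (simp add: \<beta>_def)
  have sat: "4 * real m * h \<le> (\<Sum>x\<in>C. real (codeg C D x))"
    if C: "finite C" "C \<subseteq> carrier G" and D: "finite D" "card D \<le> m" and thr: "thr < real (card C)" for C D
  proof -
    define t where "t = nat \<lceil>\<epsilon> * real m\<rceil>"
    \<comment> \<open>Rounding up at most doubles \<open>\<epsilon> * m\<close>, which is at least
      1.\<close>
    have t: "\<epsilon> * real m \<le> real t" "real t \<le> 2 * (\<epsilon> * real m)"
      using nat_ceiling_bounds[of "\<epsilon> * real m"] em unfolding t_def by linarith+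
    have "0 \<le> (real m + \<beta>) / 2" using \<beta>0 by simp
    then have "real t \<le> real (card C)" using t thr unfolding thr_def by linarith
    then have "real t * (min M (2 * real (card C) - real t - \<beta>) - real (card D)) \<le> (\<Sum>x\<in>C. real (codeg C D x))"
      using C D \<beta>0
      by (intro supersaturation) (auto simp: \<beta>_def beta_at_def M_def \<epsilon>_def intro!: beta_ge_card)
    moreover have "M \<le> 2 * real (card C) - real t - \<beta>" using thr t by (simp add: thr_def M_def field_simps)
    ultimately have "real t * (M - real (card D)) \<le> (\<Sum>x\<in>C. real (codeg C D x))" by (simp add: min_absorb1)
    moreover have "(\<epsilon> * real m) * (\<epsilon> * real m) \<le> real t * (M - real (card D))"
      using t D em by (intro mult_mono) (auto simp: M_def)
    moreover have "(\<epsilon> * real m) * (\<epsilon> * real m) = 4 * real m * h" by (simp add: h_def power2_eq_square)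
    ultimately show ?thesis by linarith
  qed
  \<comment> \<open>With \<open>f \<ge> 2 * r\<close> the ratio \<open>f / (f - r)\<close> is at
    most 2, so first-round containers have at most \<open>2 * m\<close> elements.\<close>
  define f where "f = nat \<lceil>2 * r\<rceil>"
  have f: "2 * r \<le> real f" "real f \<le> 3 * r" using nat_ceiling_bounds[of "2 * r"] r1
    unfolding f_def by linarith+
  then have f1: "1 \<le> f" using r1 by linarith
  define K where "K = 2 powr (thr + 112 * (\<epsilon> * real m))"
  \<comment> \<open>112 is 96 + 16: \<open>k + 2 \<le> 4 * r\<close> gives the first term, and
    \<open>k \<ge> r\<close> the second.\<close>
  have exps: "(3 * real m * q + real m / d) * L \<le> 112 * (\<epsilon> * real m)"
  proof -
    have e2: "(r / \<epsilon>\<^sup>2) * L = \<epsilon> * real m"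
      using \<epsilon>3 \<epsilon>0 by (simp add: field_simps power2_eq_square power3_eq_cube)
    have "3 * real m * q = 24 * (real k + 2) / \<epsilon>\<^sup>2" using m \<epsilon>0 by (simp add: q_def h_def field_simps)
    also have "\<dots> \<le> 24 * (4 * r) / \<epsilon>\<^sup>2" using k r1 by (intro divide_right_mono mult_left_mono) auto
    finally have 1: "3 * real m * q \<le> 96 * (r / \<epsilon>\<^sup>2)" by simp
    have "real m / d = 16 * (r * r / real k) / \<epsilon>\<^sup>2" using m \<epsilon>0 k1 rr by (simp add: d_def h_def field_simps)
    also have "\<dots> \<le> 16 * r / \<epsilon>\<^sup>2"
    proof (intro divide_right_mono mult_left_mono)
      show "r * r / real k \<le> r" using k k1 r1 by (simp add: pos_divide_le_eq mult_left_mono)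
    qed auto
    finally have "3 * real m * q + real m / d \<le> 112 * (r / \<epsilon>\<^sup>2)" using 1 by simp
    then have "(3 * real m * q + real m / d) * L \<le> 112 * (r / \<epsilon>\<^sup>2) * L" using L1 by (intro mult_right_mono) auto
    then show ?thesis using e2 by simp
  qed
  have "real (card (family m Y {})) \<le> real n ^ f * (1 + 3 * K * real n powr ((real m - real f) / r))"
  proof (rule card_family_first_round[OF Y n f1])
    fix C D :: "'a set"
    assume C: "C \<subseteq> Y" and D: "finite D" "card D \<le> m"
      and c: "real (card C) * (real f - r) \<le> real f * real m"
    have fC: "finite C" "C \<subseteq> carrier G" "card C \<le> n" using C Y card_mono by (auto dest: finite_subset)
    have "real f * real m \<le> (2 * (real f - r)) * real m" using f by (intro mult_right_mono) auto
    then have "real (card C) * (real f - r) \<le> 2 * real m * (real f - r)" using c by (simp add: algebra_simps)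
    then have "real (card C) \<le> 2 * real m" using f r1 by simp
    then have cC: "card C \<le> 2 * m" by linarith
    have "real (card (family m C D)) \<le>
      2 powr thr * real n powr (q * (real (card C) + real m - real (card D)) + (real m - real (card D)) / d)"
      by (rule card_family_le_of_supersaturation[OF n m k1 h0 d_def q_def]) (use sat fC D cC in auto)
    also have "\<dots> \<le> 2 powr thr * real n powr (3 * real m * q + real m / d)"
    proof (intro mult_left_mono powr_mono add_mono)
      have "q * (real (card C) + real m - real (card D)) \<le> q * (3 * real m)"
        using q0 cC by (intro mult_left_mono) auto
      then show "q * (real (card C) + real m - real (card D)) \<le> 3 * real m * q" by (simp add: mult.commute)
      show "(real m - real (card D)) / d \<le> real m / d" using d0 by (intro divide_right_mono) auto
    qed (use n1 in auto)
    also have "\<dots> = 2 powr (thr + (3 * real m * q + real m / d) * L)" unfolding npow by (simp add: powr_add)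
    also have "\<dots> \<le> K" unfolding K_def using exps by (intro powr_mono) auto
    finally show "real (card (family m C D)) \<le> K" .
  qed (use r1 in \<open>auto simp: K_def\<close>)
  also have "\<dots> = real n powr real f + 3 * K * real n powr (real f + (real m - real f) / r)"
    using n by (simp add: powr_realpow powr_add algebra_simps)
  also have "\<dots> \<le> K * real n powr (4 * r) + 3 * K * real n powr (4 * r)"
  proof (intro add_mono mult_left_mono)
    have "0 \<le> thr" using \<beta>0 em by (simp add: thr_def)
    then have "1 * real n powr real f \<le> K * real n powr (4 * r)"
      using f r1 n1 em by (intro mult_mono powr_mono) (auto simp: K_def intro!: ge_one_powr_ge_zero)
    then show "real n powr real f \<le> K * real n powr (4 * r)" by simp
    have "(real m - real f) / r \<le> r" using f r1 rr by (simp add: pos_divide_le_eq)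
    then show "real n powr (real f + (real m - real f) / r) \<le> real n powr (4 * r)"
      using n1 f by (intro powr_mono) auto
  qed (auto simp: K_def)
  also have "\<dots> = 2 powr (2 + (thr + 112 * (\<epsilon> * real m)) + 4 * r * L)"
    unfolding K_def npow by (simp add: powr_add)
  \<comment> \<open>Beyond \<open>(m + \<beta>) / 2\<close> the exponent is at most
    \<open>120 * \<epsilon> * m\<close>: 2 from \<open>thr\<close>, 112 from the iteration, 4 from
    the first round and 2 from the constant.\<close>
  also have "\<dots> \<le> 2 powr ((real m + \<beta>) / 2 + 2 ^ 13 * \<epsilon> * real m)"
    using em rLm by (intro powr_mono) (auto simp: thr_def)
  finally show ?thesis by (simp add: \<beta>_def \<epsilon>_def)
qed

end


section \<open>Asymptotics\<close>

text \<open>The empty set is always a member; positivity permits taking logarithms of the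
  count.\<close>

lemma card_small_sumset_family_pos:
  assumes "finite Y"
  shows "1 \<le> card (small_sumset_family G Y m)"
proof -
  have "small_sumset_family G Y m \<subseteq> Pow Y" by (auto simp: small_sumset_family_def)
  then have "finite (small_sumset_family G Y m)" using assms by (auto dest: finite_subset)
  moreover have "{} \<in> small_sumset_family G Y m" by (auto simp: small_sumset_family_def set_mult_def)
  ultimately have "0 < card (small_sumset_family G Y m)" by (auto simp: card_gt_0_iff)
  then show ?thesis by simp
qed

text \<open>Let \<open>e\<close> be the excess of the normalised logarithm over 2, cut off at 0, so
  the inequality holds for every \<open>k\<close>. Once the sparse bound applies,
  \<open>m = a^2 * L * r\<close> gives \<open>e \<le> 3 * a + a^2\<close>, which tends to 0.\<close>

lemma small_sumset_family_sparse_asymptotics: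
  fixes n m :: "nat \<Rightarrow> nat" and c :: "nat \<Rightarrow> real"
  assumes nm: "\<And>k. 2 \<le> n k" "\<And>k. 1 \<le> m k" and c: "\<And>k. 1 \<le> c k"
    and bound: "\<And>k. real (m k) \<le> (log 2 (real (n k)))\<^sup>2 \<Longrightarrow>
      c k \<le> 2 powr ((2 + 3 * alpha (n k) (m k)) * sqrt (real (m k)) * log 2 (real (n k)) + real (m k))"
    and small: "(\<lambda>k. real (m k)) \<in> o(\<lambda>k. (log 2 (real (n k)))\<^sup>2)"
  shows "\<exists>e. e \<in> o(\<lambda>_. 1) \<and> (\<forall>k. c k \<le> real (n k) powr ((2 + e k) * sqrt (real (m k))))"
proof -
  define L where "L k = log 2 (real (n k))" for k
  define a where "a k = alpha (n k) (m k)" for k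
  define r where "r k = sqrt (real (m k))" for k
  have L1: "1 \<le> L k" and a0: "0 < a k" and aL: "(a k)\<^sup>2 * L k = r k" for k
    using alpha_pos[OF nm] by (auto simp: L_def a_def r_def)
  have r1: "1 \<le> r k" and rr: "r k * r k = real (m k)" for k using nm(2)[of k] by (auto simp: r_def)
  have lim: "(\<lambda>k. real (m k) / (L k)\<^sup>2) \<longlonglongrightarrow> 0"
    using smalloD_tendsto[OF small] by (simp add: L_def)
  \<comment> \<open>\<alpha> is the fourth root of m / (log n)^2.\<close>
  have a_eq: "a = (\<lambda>k. sqrt (sqrt (real (m k) / (L k)\<^sup>2)))"
  proof
    fix k
    have "0 \<le> r k / L k" using L1[of k] r1[of k] by simp
    then show "a k = sqrt (sqrt (real (m k) / (L k)\<^sup>2))"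
      using L1[of k] by (simp add: a_def alpha_def powr_half_sqrt real_sqrt_divide r_def L_def)
  qed
  have a_lim: "a \<longlonglongrightarrow> 0"
    unfolding a_eq using tendsto_real_sqrt[OF tendsto_real_sqrt[OF lim]] by simp
  define e where "e k = max 0 (log 2 (c k) / (L k * r k) - 2)" for k
  have "eventually (\<lambda>k. real (m k) / (L k)\<^sup>2 < 1) sequentially"
    using lim by (rule order_tendstoD) simp
  then have ev: "eventually (\<lambda>k. e k \<le> 3 * a k + (a k)\<^sup>2) sequentially"
  proof eventually_elim
    case (elim k)
    have "real (m k) \<le> (L k)\<^sup>2" using elim L1[of k] by (simp add: divide_less_eq)
    then have "log 2 (c k) \<le> (2 + 3 * a k) * r k * L k + real (m k)"
      using bound[of k] c[of k] by (simp add: log_le_iff L_def a_def r_def)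
    also have "real (m k) = (a k)\<^sup>2 * (L k * r k)" using aL[of k] rr[of k] by (simp flip: mult.assoc)
    finally have "log 2 (c k) \<le> (2 + 3 * a k + (a k)\<^sup>2) * (L k * r k)" by (simp add: algebra_simps)
    moreover have "0 < L k * r k" using L1[of k] r1[of k] by (intro mult_pos_pos) auto
    ultimately have "log 2 (c k) / (L k * r k) \<le> 2 + 3 * a k + (a k)\<^sup>2" by (simp add: pos_divide_le_eq)
    then show ?case using a0[of k] by (simp add: e_def)
  qed
  have "e \<longlonglongrightarrow> 0"
  proof (rule tendsto_sandwich[OF _ ev tendsto_const])
    show "eventually (\<lambda>k. 0 \<le> e k) sequentially" by (simp add: e_def)
    show "(\<lambda>k. 3 * a k + (a k)\<^sup>2) \<longlonglongrightarrow> 0" using a_lim by (auto intro!: tendsto_eq_intros)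
  qed
  then have "e \<in> o(\<lambda>_. 1)" by (intro smalloI_tendsto) auto
  moreover have "c k \<le> real (n k) powr ((2 + e k) * r k)" for k
  proof -
    have pos: "0 < L k * r k" using L1[of k] r1[of k] by (intro mult_pos_pos) auto
    have "log 2 (c k) / (L k * r k) \<le> 2 + e k" by (simp add: e_def)
    then have "log 2 (c k) \<le> (2 + e k) * (L k * r k)" using pos by (simp add: pos_divide_le_eq)
    then have "c k \<le> 2 powr ((2 + e k) * (L k * r k))" using c[of k] by (simp add: log_le_iff)
    also have "\<dots> = (2 powr L k) powr ((2 + e k) * r k)" by (simp add: powr_powr mult_ac)
    also have "2 powr L k = real (n k)" using nm(1)[of k] by (simp add: L_def)
    finally show ?thesis .
  qed
  ultimately show ?thesis by (auto simp: r_def)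
qed

text \<open>Again \<open>e\<close> is the excess of the logarithm, now over \<open>b\<close>, cut
  off at 0; only its size relative to \<open>m\<close> for large \<open>k\<close> has to be
  estimated.\<close>

lemma small_sumset_family_dense_asymptotics:
  fixes n m :: "nat \<Rightarrow> nat" and b c :: "nat \<Rightarrow> real"
  assumes nm: "\<And>k. 2 \<le> n k" "\<And>k. 1 \<le> m k" and c: "\<And>k. 1 \<le> c k"
    and bound: "\<And>k. (log 2 (real (n k)))\<^sup>2 < real (m k) \<Longrightarrow>
      c k \<le> 2 powr (b k + 2 ^ 13 * alpha (n k) (m k) powr (- 2 / 3) * real (m k))"
    and small: "(\<lambda>k. (log 2 (real (n k)))\<^sup>2) \<in> o(\<lambda>k. real (m k))"
  shows "\<exists>e. e \<in> o(\<lambda>k. real (m k)) \<and> (\<forall>k. c k \<le> 2 powr (b k + e k))"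
proof -
  define L where "L k = log 2 (real (n k))" for k
  define \<epsilon> where "\<epsilon> k = alpha (n k) (m k) powr (- 2 / 3)" for k
  have m0: "0 < real (m k)" for k using nm(2)[of k] by simp
  have \<epsilon>0: "0 \<le> \<epsilon> k" and L1: "1 \<le> L k" for k using alpha_pos[OF nm] by (auto simp: L_def \<epsilon>_def)
  have lim: "(\<lambda>k. (L k)\<^sup>2 / real (m k)) \<longlonglongrightarrow> 0"
    using smalloD_tendsto[OF small] by (simp add: L_def)
  \<comment> \<open>\<epsilon> is the sixth root of (log n)^2 / m.\<close>
  have \<epsilon>_eq: "\<epsilon> = (\<lambda>k. root 3 (sqrt ((L k)\<^sup>2 / real (m k))))"
  proof
    fix k
    have "sqrt ((L k)\<^sup>2 / real (m k)) = L k / sqrt (real (m k))" using L1[of k] by (simp add: real_sqrt_divide)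
    also have "\<dots> = \<epsilon> k ^ 3"
      using alpha_powr_cube[OF nm, of k k] m0[of k] by (simp add: L_def \<epsilon>_def field_simps)
    finally show "\<epsilon> k = root 3 (sqrt ((L k)\<^sup>2 / real (m k)))" using \<epsilon>0[of k] by (simp add: real_root_power_cancel)
  qed
  have \<epsilon>_lim: "\<epsilon> \<longlonglongrightarrow> 0"
    unfolding \<epsilon>_eq using tendsto_real_root[OF tendsto_real_sqrt[OF lim], of 3] by simp
  define e where "e k = max 0 (log 2 (c k) - b k)" for k
  have "eventually (\<lambda>k. (L k)\<^sup>2 / real (m k) < 1) sequentially"
    using lim by (rule order_tendstoD) simp
  then have ev: "eventually (\<lambda>k. e k / real (m k) \<le> 2 ^ 13 * \<epsilon> k) sequentially"
  proof eventually_elim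
    case (elim k)
    have "(L k)\<^sup>2 < real (m k)" using elim m0[of k] by (simp add: divide_less_eq)
    then have "log 2 (c k) \<le> b k + 2 ^ 13 * \<epsilon> k * real (m k)"
      using bound[of k] c[of k] by (simp add: log_le_iff L_def \<epsilon>_def)
    then have "e k \<le> 2 ^ 13 * \<epsilon> k * real (m k)" using \<epsilon>0[of k] m0[of k] by (simp add: e_def)
    then show ?case using m0[of k] by (simp add: pos_divide_le_eq)
  qed
  have "(\<lambda>k. e k / real (m k)) \<longlonglongrightarrow> 0"
  proof (rule tendsto_sandwich[OF _ ev tendsto_const])
    show "eventually (\<lambda>k. 0 \<le> e k / real (m k)) sequentially" by (simp add: e_def)
    show "(\<lambda>k. 2 ^ 13 * \<epsilon> k) \<longlonglongrightarrow> 0" using \<epsilon>_lim by (auto intro!: tendsto_eq_intros)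
  qed
  then have "e \<in> o(\<lambda>k. real (m k))" using m0 by (intro smalloI_tendsto) auto
  moreover have "c k \<le> 2 powr (b k + e k)" for k
  proof -
    have "log 2 (c k) \<le> b k + e k" by (simp add: e_def)
    then show ?thesis using c[of k] by (simp add: log_le_iff)
  qed
  ultimately show ?thesis by blast
qed

section \<open>Combination for single groups and for sequences\<close>

lemma card_small_sumset_family_le:
  assumes "2 \<le> n" "1 \<le> m" "comm_group G" "Y \<subseteq> carrier G" "finite Y" "card Y = n"
  shows "real (card (small_sumset_family G Y m)) \<le>
    (if real m \<le> (log 2 (real n))\<^sup>2
     then 2 powr ((2 + 3 * alpha n m) * sqrt (real m) * log 2 (real n) + real m)
     else 2 powr ((real m + real (beta_at G n m)) / 2 + 2 ^ 13 * alpha n m powr (- 2 / 3) * real m))"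
proof -
  interpret comm_group G by fact
  show ?thesis
    using card_family_sparse[OF assms(5,4,6,1,2)] card_family_dense[OF assms(5,4,6,1,2)]
      small_sumset_family_eq_family[OF assms(5)] by simp
qed

theorem theorem1p4:
  "(\<forall>(G :: ('a, 'b) monoid_scheme) (Y :: 'a set) (n :: nat) (m :: nat).
      n \<ge> 2 \<longrightarrow> m \<ge> 1 \<longrightarrow> comm_group G \<longrightarrow> Y \<subseteq> carrier G \<longrightarrow> finite Y \<longrightarrow> card Y = n \<longrightarrow>
      real (card (small_sumset_family G Y m)) \<le>
        (if real m \<le> (log 2 (real n))\<^sup>2
         then 2 powr ((2 + 3 * alpha n m) * sqrt (real m) * log 2 (real n) + real m)
         else 2 powr ((real m + real (beta_at G n m)) / 2
                        + 2 ^ 13 * alpha n m powr (- 2 / 3) * real m)))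
   \<and>
   (\<forall>(G :: nat \<Rightarrow> ('a, 'b) monoid_scheme) (Y :: nat \<Rightarrow> 'a set) (n :: nat \<Rightarrow> nat) (m :: nat \<Rightarrow> nat).
      (\<forall>k. n k \<ge> 2 \<and> m k \<ge> 1 \<and> comm_group (G k) \<and> Y k \<subseteq> carrier (G k) \<and>
           finite (Y k) \<and> card (Y k) = n k) \<longrightarrow>
      filterlim n at_top sequentially \<longrightarrow>
      ((\<lambda>k. real (m k)) \<in> o(\<lambda>k. (log 2 (real (n k)))\<^sup>2) \<longrightarrow>
         (\<exists>e :: nat \<Rightarrow> real. e \<in> o(\<lambda>_. 1) \<and>
            (\<forall>k. real (card (small_sumset_family (G k) (Y k) (m k)))
                   \<le> real (n k) powr ((2 + e k) * sqrt (real (m k)))))) \<and>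
      ((\<lambda>k. (log 2 (real (n k)))\<^sup>2) \<in> o(\<lambda>k. real (m k)) \<longrightarrow>
         (\<exists>e :: nat \<Rightarrow> real. e \<in> o(\<lambda>k. real (m k)) \<and>
            (\<forall>k. real (card (small_sumset_family (G k) (Y k) (m k)))
                   \<le> 2 powr ((real (m k) + real (beta_at (G k) (n k) (m k))) / 2 + e k)))))"
proof (intro conjI allI impI, goal_cases)
  case (1 G Y n m)
  then show ?case using card_small_sumset_family_le by blast
next
  case (2 G Y n m)
  then have h: "2 \<le> n k" "1 \<le> m k" "comm_group (G k)" "Y k \<subseteq> carrier (G k)" "finite (Y k)"
    "card (Y k) = n k" for k by auto
  show ?case
  proof (rule small_sumset_family_sparse_asymptotics)
    fix k
    show "1 \<le> real (card (small_sumset_family (G k) (Y k) (m k)))"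
      using card_small_sumset_family_pos[OF h(5)[of k], of "G k" "m k"] by simp
    assume "real (m k) \<le> (log 2 (real (n k)))\<^sup>2"
    then show "real (card (small_sumset_family (G k) (Y k) (m k))) \<le> 2 powr
        ((2 + 3 * alpha (n k) (m k)) * sqrt (real (m k)) * log 2 (real (n k)) + real (m k))"
      using card_small_sumset_family_le[OF h[of k]] by simp
  qed (use h 2 in auto)
next
  case (3 G Y n m)
  then have h: "2 \<le> n k" "1 \<le> m k" "comm_group (G k)" "Y k \<subseteq> carrier (G k)" "finite (Y k)"
    "card (Y k) = n k" for k by auto
  show ?case
  proof (rule small_sumset_family_dense_asymptotics)
    fix k
    show "1 \<le> real (card (small_sumset_family (G k) (Y k) (m k)))"
      using card_small_sumset_family_pos[OF h(5)[of k], of "G k" "m k"] by simp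
    assume "(log 2 (real (n k)))\<^sup>2 < real (m k)"
    then show "real (card (small_sumset_family (G k) (Y k) (m k))) \<le> 2 powr
        ((real (m k) + real (beta_at (G k) (n k) (m k))) / 2
          + 2 ^ 13 * alpha (n k) (m k) powr (- 2 / 3) * real (m k))"
      using card_small_sumset_family_le[OF h[of k]] by simp
  qed (use h 3 in auto)
qed

end
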